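(* There is an adjunction $\mathit{fin}:\mathbf{BiFrm}\leftrightarrows\mathbf{BiFrm_{fin}}:i$ with $i\dashv \mathit{fin}$, with unit $\eta$ and counit $\varepsilon$.
   Context: A biframe is a triple $\mathcal L=(L^+,L^-,L)$ of frames with injective frame maps $e_L^{\pm}:L^{\pm}\to L$ such that every element of $L$ (the main component) is a join of elements $e_L^+(x^+)\wedge e_L^-(x^-)$. A biframe map $(f^+,f^-):\mathcal L\to\mathcal M$ is a pair of frame maps $f^{\pm}:L^{\pm}\to M^{\pm}$ for which there is a (necessarily unique) frame map $f:L\to M$ with $f\circ e_L^{\pm}=e_M^{\pm}\circ f^{\pm}$. $\mathbf{BiFrm}$ is the category of biframes. A relation $R$ on a frame is treated as a set of inequalities: the quotient by $R$ is the universal frame quotient $q$ with $q(a)\le q(b)$ for all $(a,b)\in R$, and the congruence generated by $R$ is the kernel of $q$. For a biframe $\mathcal L$, $\mathsf{fin}(L)\subseteq L$ is the set of finite joins of elements $e_L^+(x^+)\wedge e_L^-(x^-)$; a congruence on $L$ is finitary if it is generated by some relation $R\subseteq \mathsf{fin}(L)\times\mathsf{fin}(L)$. Let $L^+\oplus L^-$ be the frame coproduct and $C_L$ the kernel of the canonical surjection $L^+\oplus L^-\to L$. $\mathcal L$ is finitary if $C_L$ is a finitary congruence on $L^+\oplus L^-$ (the main component of the biframe $(L^+,L^-,L^+\oplus L^-)$). $\mathbf{BiFrm_{fin}}$ is the full subcategory of finitary biframes and $i$ is its inclusion into $\mathbf{BiFrm}$. For a biframe $\mathcal L$, let $\mathit{fin}(C_L)$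 be the congruence on $L^+\oplus L^-$ generated by $C_L\cap(\mathsf{fin}(L^+\oplus L^-)\times \mathsf{fin}(L^+\oplus L^-))$, and $\mathit{fin}(\mathcal L)=(L^+,L^-,(L^+\oplus L^-)/\mathit{fin}(C_L))$. On morphisms $\mathit{fin}$ sends a biframe map $(f^+,f^-)$ to the same pair of frame maps. The unit $\eta_{\mathcal L}:\mathcal L\to\mathit{fin}(i(\mathcal L))$ ($\mathcal L$ finitary) and the counit $\varepsilon_{\mathcal L}:i(\mathit{fin}(\mathcal L))\to\mathcal L$ ($\mathcal L$ any biframe) are the pairs of identity maps $(\mathrm{id}_{L^+},\mathrm{id}_{L^-})$. *)

theory Defs
  imports "HOL-Algebra.Complete_Lattice" "HOL-Library.FuncSet"
begin

section \<open>Frames\<close>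

locale frame = complete_lattice L for L (structure) +
  assumes meet_sup_distrib:
    "\<lbrakk>x \<in> carrier L; A \<subseteq> carrier L\<rbrakk> \<Longrightarrow> x \<sqinter> \<Squnion>A = \<Squnion>((\<lambda>a. x \<sqinter> a) ` A)"

text \<open>Maps are extensional functions, so that equality of maps is equality on carriers.
  Preservation of the empty join is included in the second clause.\<close>

definition frame_hom ::
    "('a, 'c) gorder_scheme \<Rightarrow> ('b, 'd) gorder_scheme \<Rightarrow> ('a \<Rightarrow> 'b) set" where
  "frame_hom L M = {f \<in> carrier L \<rightarrow>\<^sub>E carrier M.
     (\<forall>A. A \<subseteq> carrier L \<longrightarrow> f (\<Squnion>\<^bsub>L\<^esub>A) = \<Squnion>\<^bsub>M\<^esub>(f ` A)) \<and>
     (\<forall>x \<in> carrier L. \<forall>y \<in> carrier L. f (x \<sqinter>\<^bsub>L\<^esub> y) = f x \<sqinter>\<^bsub>M\<^esub> f y) \<and>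
     f \<top>\<^bsub>L\<^esub> = \<top>\<^bsub>M\<^esub>}"

definition hom_kernel :: "('a, 'c) gorder_scheme \<Rightarrow> ('a \<Rightarrow> 'b) \<Rightarrow> ('a \<times> 'a) set" where
  "hom_kernel L f = {(x, y) \<in> carrier L \<times> carrier L. f x = f y}"


section \<open>Congruences and quotients\<close>

definition frame_congruence :: "('a, 'c) gorder_scheme \<Rightarrow> ('a \<times> 'a) set \<Rightarrow> bool" where
  "frame_congruence L C \<longleftrightarrow> equiv (carrier L) C \<and>
     (\<forall>S. S \<subseteq> C \<longrightarrow> (\<Squnion>\<^bsub>L\<^esub>(fst ` S), \<Squnion>\<^bsub>L\<^esub>(snd ` S)) \<in> C) \<and>
     (\<forall>(x, y) \<in> C. \<forall>(x', y') \<in> C. (x \<sqinter>\<^bsub>L\<^esub> x', y \<sqinter>\<^bsub>L\<^esub> y') \<in> C)"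

definition quot_frame :: "('a, 'c) gorder_scheme \<Rightarrow> ('a \<times> 'a) set \<Rightarrow> 'a set gorder" where
  "quot_frame L C = \<lparr>carrier = carrier L // C, eq = (=),
     le = (\<lambda>X Y. \<exists>x \<in> X. \<exists>y \<in> Y. x \<sqsubseteq>\<^bsub>L\<^esub> y)\<rparr>"

definition quot_map :: "('a, 'c) gorder_scheme \<Rightarrow> ('a \<times> 'a) set \<Rightarrow> 'a \<Rightarrow> 'a set" where
  "quot_map L C = (\<lambda>x \<in> carrier L. C `` {x})"

text \<open>A relation \<open>R\<close> is read as a set of inequalities: \<open>(a, b) \<in> R\<close> imposes
  \<open>a \<le> b\<close>, that is, \<open>a \<sqinter> b = a\<close>. The congruence below is the kernel of the universal
  quotient imposing these inequalities; see \<open>quot_gen_congruence\<close> and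
  \<open>quot_gen_congruence_universal\<close>.\<close>

definition gen_congruence ::
    "('a, 'c) gorder_scheme \<Rightarrow> ('a \<times> 'a) set \<Rightarrow> ('a \<times> 'a) set" where
  "gen_congruence L R =
     \<Inter>{C. frame_congruence L C \<and> (\<forall>(a, b) \<in> R. (a \<sqinter>\<^bsub>L\<^esub> b, a) \<in> C)}"

lemma frame_homD:
  assumes "f \<in> frame_hom L M"
  shows "\<And>x. x \<in> carrier L \<Longrightarrow> f x \<in> carrier M"
    and "\<And>A. A \<subseteq> carrier L \<Longrightarrow> f (\<Squnion>\<^bsub>L\<^esub>A) = \<Squnion>\<^bsub>M\<^esub>(f ` A)"
    and "\<And>x y. x \<in> carrier L \<Longrightarrow> y \<in> carrier L \<Longrightarrow> f (x \<sqinter>\<^bsub>L\<^esub> y) = f x \<sqinter>\<^bsub>M\<^esub> f y"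
    and "f \<top>\<^bsub>L\<^esub> = \<top>\<^bsub>M\<^esub>"
    and "f \<in> extensional (carrier L)"
  using assms unfolding frame_hom_def by (auto simp: PiE_def)

lemma frame_homI:
  assumes "\<And>x. x \<in> carrier L \<Longrightarrow> f x \<in> carrier M"
    and "\<And>A. A \<subseteq> carrier L \<Longrightarrow> f (\<Squnion>\<^bsub>L\<^esub>A) = \<Squnion>\<^bsub>M\<^esub>(f ` A)"
    and "\<And>x y. x \<in> carrier L \<Longrightarrow> y \<in> carrier L \<Longrightarrow> f (x \<sqinter>\<^bsub>L\<^esub> y) = f x \<sqinter>\<^bsub>M\<^esub> f y"
    and "f \<top>\<^bsub>L\<^esub> = \<top>\<^bsub>M\<^esub>"
    and "f \<in> extensional (carrier L)"
  shows "f \<in> frame_hom L M"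
  using assms unfolding frame_hom_def by (auto simp: PiE_def)

context complete_lattice
begin

lemma sup_eqI:
  assumes "A \<subseteq> carrier L" "s \<in> carrier L" "\<And>a. a \<in> A \<Longrightarrow> a \<sqsubseteq> s"
    and "\<And>u. u \<in> carrier L \<Longrightarrow> (\<And>a. a \<in> A \<Longrightarrow> a \<sqsubseteq> u) \<Longrightarrow> s \<sqsubseteq> u"
  shows "\<Squnion>A = s"
  by (rule le_antisym) (use assms sup_least sup_upper in auto)

lemma meet_eqI:
  assumes "x \<in> carrier L" "y \<in> carrier L" "m \<in> carrier L" "m \<sqsubseteq> x" "m \<sqsubseteq> y"
    and "\<And>u. u \<in> carrier L \<Longrightarrow> u \<sqsubseteq> x \<Longrightarrow> u \<sqsubseteq> y \<Longrightarrow> u \<sqsubseteq> m"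
  shows "x \<sqinter> y = m"
  by (rule le_antisym) (use assms meet_le meet_left meet_right in auto)

lemma top_eqI:
  assumes "t \<in> carrier L" "\<And>u. u \<in> carrier L \<Longrightarrow> u \<sqsubseteq> t"
  shows "\<top> = t"
  by (rule le_antisym) (use assms in auto)

lemma le_iff_meet_eq:
  "\<lbrakk>x \<in> carrier L; y \<in> carrier L\<rbrakk> \<Longrightarrow> x \<sqsubseteq> y \<longleftrightarrow> x \<sqinter> y = x"
  using weak_le_iff_join eq_is_equal by (metis (full_types))

end

lemma frame_complete: "frame L \<Longrightarrow> complete_lattice L"
  by (rule frame.axioms(1))

lemma frame_hom_mono:
  assumes "complete_lattice L" "complete_lattice M" "f \<in> frame_hom L M"
    and "x \<in> carrier L" "y \<in> carrier L" "x \<sqsubseteq>\<^bsub>L\<^esub> y"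
  shows "f x \<sqsubseteq>\<^bsub>M\<^esub> f y"
proof -
  interpret L: complete_lattice L by fact
  interpret M: complete_lattice M by fact
  show ?thesis
    using assms(4-6) frame_homD(1,3)[OF assms(3)] L.le_iff_meet_eq M.le_iff_meet_eq by metis
qed

lemma frame_congruence_meet:
  assumes "frame_congruence L C" "(x, y) \<in> C" "(x', y') \<in> C"
  shows "(x \<sqinter>\<^bsub>L\<^esub> x', y \<sqinter>\<^bsub>L\<^esub> y') \<in> C"
proof -
  have "\<forall>(x, y) \<in> C. \<forall>(x', y') \<in> C. (x \<sqinter>\<^bsub>L\<^esub> x', y \<sqinter>\<^bsub>L\<^esub> y') \<in> C"
    using assms(1) by (simp add: frame_congruence_def)
  from bspec[OF this assms(2)] have "\<forall>(x', y') \<in> C. (x \<sqinter>\<^bsub>L\<^esub> x', y \<sqinter>\<^bsub>L\<^esub> y') \<in> C"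
    by simp
  from bspec[OF this assms(3)] show ?thesis by simp
qed

lemma frame_congruence_sup:
  assumes "frame_congruence L C" "S \<subseteq> C"
  shows "(\<Squnion>\<^bsub>L\<^esub>(fst ` S), \<Squnion>\<^bsub>L\<^esub>(snd ` S)) \<in> C"
  using assms by (simp add: frame_congruence_def)

lemma frame_congruence_gen:
  assumes "frame L" and R: "R \<subseteq> carrier L \<times> carrier L"
  shows "frame_congruence L (gen_congruence L R)"
    and "\<And>a b. (a, b) \<in> R \<Longrightarrow> (a \<sqinter>\<^bsub>L\<^esub> b, a) \<in> gen_congruence L R"
proof -
  interpret L: frame L by fact
  define K where "K = {C. frame_congruence L C \<and> (\<forall>(a, b) \<in> R. (a \<sqinter>\<^bsub>L\<^esub> b, a) \<in> C)}"
  have gen: "gen_congruence L R = \<Inter>K"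
    by (simp add: gen_congruence_def K_def)
  have "equiv (carrier L) (carrier L \<times> carrier L)"
    by (auto simp: equiv_def refl_on_def sym_def trans_def)
  moreover have "\<Squnion>\<^bsub>L\<^esub>(fst ` S) \<in> carrier L \<and> \<Squnion>\<^bsub>L\<^esub>(snd ` S) \<in> carrier L"
    if "S \<subseteq> carrier L \<times> carrier L" for S
    using that by (intro conjI L.sup_closed) auto
  ultimately have full: "carrier L \<times> carrier L \<in> K"
    using R unfolding K_def frame_congruence_def by auto
  have K1: "equiv (carrier L) C" if "C \<in> K" for C
    using that by (simp add: K_def frame_congruence_def)
  show "frame_congruence L (gen_congruence L R)"
    unfolding frame_congruence_def gen
  proof (intro conjI allI impI)
    show "equiv (carrier L) (\<Inter>K)"
    proof (rule equivI)
      show "\<Inter>K \<subseteq> carrier L \<times> carrier L" using full by blast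
      show "refl_on (carrier L) (\<Inter>K)"
        using K1 by (fastforce simp: refl_on_def equiv_def)
      show "sym (\<Inter>K)"
        using K1 by (meson InterE InterI equiv_def symD symI)
      show "trans (\<Inter>K)"
        using K1 by (meson InterE InterI equiv_def transD transI)
    qed
    fix S assume S: "S \<subseteq> \<Inter>K"
    show "(\<Squnion>\<^bsub>L\<^esub>(fst ` S), \<Squnion>\<^bsub>L\<^esub>(snd ` S)) \<in> \<Inter>K"
    proof
      fix C assume C: "C \<in> K"
      then have "frame_congruence L C" by (simp add: K_def)
      then show "(\<Squnion>\<^bsub>L\<^esub>(fst ` S), \<Squnion>\<^bsub>L\<^esub>(snd ` S)) \<in> C"
        by (rule frame_congruence_sup) (use S C in blast)
    qed
  next
    show "\<forall>(x, y) \<in> \<Inter>K. \<forall>(x', y') \<in> \<Inter>K. (x \<sqinter>\<^bsub>L\<^esub> x', y \<sqinter>\<^bsub>L\<^esub> y') \<in> \<Inter>K"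
    proof clarify
      fix x y x' y' C assume *: "(x, y) \<in> \<Inter>K" "(x', y') \<in> \<Inter>K" "C \<in> K"
      have "frame_congruence L C" using *(3) by (simp add: K_def)
      moreover have "(x, y) \<in> C" "(x', y') \<in> C" using * by auto
      ultimately show "(x \<sqinter>\<^bsub>L\<^esub> x', y \<sqinter>\<^bsub>L\<^esub> y') \<in> C"
        by (rule frame_congruence_meet)
    qed
  qed
  show "\<And>a b. (a, b) \<in> R \<Longrightarrow> (a \<sqinter>\<^bsub>L\<^esub> b, a) \<in> gen_congruence L R"
    unfolding gen by (auto simp: K_def)
qed

locale frame_with_congruence = frame L for L (structure) and C +
  assumes cong: "frame_congruence L C"
begin

abbreviation "Q \<equiv> quot_frame L C"
abbreviation "q \<equiv> quot_map L C"

lemma equivC: "equiv (carrier L) C"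
  using cong by (simp add: frame_congruence_def)

lemma C_carrier: "(x, y) \<in> C \<Longrightarrow> x \<in> carrier L \<and> y \<in> carrier L"
  using equivC by (auto simp: equiv_def)

lemma C_refl [simp]: "x \<in> carrier L \<Longrightarrow> (x, x) \<in> C"
  using equivC by (simp add: equiv_def refl_on_def)

lemma C_sym: "(x, y) \<in> C \<Longrightarrow> (y, x) \<in> C"
  using equivC by (meson equiv_def symD)

lemma C_trans: "(x, y) \<in> C \<Longrightarrow> (y, z) \<in> C \<Longrightarrow> (x, z) \<in> C"
  using equivC by (meson equiv_def transD)

lemma C_meet: "(x, y) \<in> C \<Longrightarrow> (x', y') \<in> C \<Longrightarrow> (x \<sqinter> x', y \<sqinter> y') \<in> C"
  using frame_congruence_meet[OF cong] by blast

lemma q_eq_iff: "x \<in> carrier L \<Longrightarrow> y \<in> carrier L \<Longrightarrow> q x = q y \<longleftrightarrow> (x, y) \<in> C"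
  using eq_equiv_class_iff[OF equivC] by (simp add: quot_map_def)

lemma q_carrier [simp]: "x \<in> carrier L \<Longrightarrow> q x \<in> carrier Q"
  by (simp add: quot_map_def quot_frame_def quotientI)

lemma q_surj: assumes "X \<in> carrier Q" obtains x where "x \<in> carrier L" "X = q x"
  using assms by (auto simp: quot_map_def quot_frame_def elim!: quotientE)

lemma q_le_iff:
  assumes x: "x \<in> carrier L" and y: "y \<in> carrier L"
  shows "q x \<sqsubseteq>\<^bsub>Q\<^esub> q y \<longleftrightarrow> (x \<sqinter> y, x) \<in> C"
proof
  assume "q x \<sqsubseteq>\<^bsub>Q\<^esub> q y"
  then obtain x' y' where xy: "(x, x') \<in> C" "(y, y') \<in> C" "x' \<sqsubseteq> y'"
    using x y by (auto simp: quot_frame_def quot_map_def)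
  then have "x' \<sqinter> y' = x'"
    using C_carrier le_iff_meet_eq by blast
  then have "(x \<sqinter> y, x') \<in> C"
    using C_meet[OF xy(1,2)] by simp
  then show "(x \<sqinter> y, x) \<in> C"
    using xy(1) by (metis C_sym C_trans)
next
  assume "(x \<sqinter> y, x) \<in> C"
  then have "x \<sqinter> y \<in> q x" "y \<in> q y" "x \<sqinter> y \<sqsubseteq> y"
    using x y equivC equiv_class_self[OF equivC]
    by (auto simp: quot_map_def equiv_def sym_def meet_right)
  then show "q x \<sqsubseteq>\<^bsub>Q\<^esub> q y"
    by (auto simp: quot_frame_def)
qed

lemma q_mono: "\<lbrakk>x \<in> carrier L; y \<in> carrier L; x \<sqsubseteq> y\<rbrakk> \<Longrightarrow> q x \<sqsubseteq>\<^bsub>Q\<^esub> q y"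
  by (simp add: q_le_iff le_iff_meet_eq)

lemma q_sup_least:
  assumes A: "A \<subseteq> carrier L" and y: "y \<in> carrier L"
    and le: "\<And>a. a \<in> A \<Longrightarrow> q a \<sqsubseteq>\<^bsub>Q\<^esub> q y"
  shows "q (\<Squnion>A) \<sqsubseteq>\<^bsub>Q\<^esub> q y"
proof -
  have "(y \<sqinter> a, a) \<in> C" if "a \<in> A" for a
    using le[OF that] q_le_iff y that A by (metis subsetD meet_comm)
  then have "(\<lambda>a. (y \<sqinter> a, a)) ` A \<subseteq> C" by auto
  then have "(\<Squnion>(fst ` (\<lambda>a. (y \<sqinter> a, a)) ` A), \<Squnion>(snd ` (\<lambda>a. (y \<sqinter> a, a)) ` A)) \<in> C"
    by (rule frame_congruence_sup[OF cong])
  then have "(\<Squnion>((\<lambda>a. y \<sqinter> a) ` A), \<Squnion>A) \<in> C"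
    by (simp add: image_image)
  then have "(\<Squnion>A \<sqinter> y, \<Squnion>A) \<in> C"
    using meet_sup_distrib[OF y A] by (simp add: meet_comm)
  then show ?thesis
    using q_le_iff A y by simp
qed

lemma partial_order_Q: "partial_order Q"
proof
  show "(.=\<^bsub>Q\<^esub>) = (=)" by (simp add: quot_frame_def)
next
  fix X assume "X \<in> carrier Q"
  then show "X \<sqsubseteq>\<^bsub>Q\<^esub> X" using q_mono by (metis q_surj le_refl)
next
  fix X Y assume *: "X \<sqsubseteq>\<^bsub>Q\<^esub> Y" "Y \<sqsubseteq>\<^bsub>Q\<^esub> X" "X \<in> carrier Q" "Y \<in> carrier Q"
  then obtain x y where [simp]: "x \<in> carrier L" "y \<in> carrier L" "X = q x" "Y = q y"
    by (metis q_surj)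
  have "(x \<sqinter> y, x) \<in> C" "(x \<sqinter> y, y) \<in> C"
    using * q_le_iff by (auto simp: meet_comm)
  then have "(x, y) \<in> C" by (metis C_sym C_trans)
  then have "X = Y" by (simp add: q_eq_iff)
  then show "X .=\<^bsub>Q\<^esub> Y" by (simp add: quot_frame_def)
next
  fix X Y Z assume *: "X \<sqsubseteq>\<^bsub>Q\<^esub> Y" "Y \<sqsubseteq>\<^bsub>Q\<^esub> Z" "X \<in> carrier Q" "Y \<in> carrier Q" "Z \<in> carrier Q"
  then obtain x y z where [simp]: "x \<in> carrier L" "y \<in> carrier L" "z \<in> carrier L"
      "X = q x" "Y = q y" "Z = q z"
    by (metis q_surj)
  have "(x \<sqinter> y, x) \<in> C" "(y \<sqinter> z, y) \<in> C"
    using * q_le_iff by auto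
  then have "(x \<sqinter> (y \<sqinter> z), x \<sqinter> y) \<in> C" "(x \<sqinter> y \<sqinter> z, x \<sqinter> z) \<in> C"
    using C_meet[OF C_refl[of x]] C_meet[OF _ C_refl[of z]] by auto
  then have "(x \<sqinter> z, x) \<in> C"
    using \<open>(x \<sqinter> y, x) \<in> C\<close> by (simp add: meet_assoc) (metis C_sym C_trans)
  then show "X \<sqsubseteq>\<^bsub>Q\<^esub> Z" by (simp add: q_le_iff)
qed (simp_all add: quot_frame_def)

lemma q_lub:
  assumes A: "A \<subseteq> carrier L"
  shows "least Q (q (\<Squnion>A)) (Upper Q (q ` A))"
proof (rule least_UpperI)
  fix X assume "X \<in> q ` A"
  then show "X \<sqsubseteq>\<^bsub>Q\<^esub> q (\<Squnion>A)" using A q_mono sup_upper by (auto simp: subset_iff)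
next
  fix Y assume Y: "Y \<in> Upper Q (q ` A)"
  then obtain y where y: "y \<in> carrier L" "Y = q y"
    by (meson Upper_closed q_surj subsetD)
  have "q ` A \<subseteq> carrier Q" using A by auto
  with Y show "q (\<Squnion>A) \<sqsubseteq>\<^bsub>Q\<^esub> Y"
    unfolding y by (intro q_sup_least) (use A y in \<open>auto simp: Upper_def\<close>)
qed (use A in auto)

lemma complete_lattice_Q: "complete_lattice Q"
proof -
  interpret Q: partial_order Q by (rule partial_order_Q)
  have rep: "\<exists>A \<subseteq> carrier L. S = q ` A" if "S \<subseteq> carrier Q" for S
    using that by (intro exI[of _ "{x \<in> carrier L. q x \<in> S}"]) (auto elim!: q_surj)
  have lub: "\<exists>s. least Q s (Upper Q S)" if S: "S \<subseteq> carrier Q" for S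
    using rep[OF S] q_lub by blast
  show ?thesis
  proof (rule Q.complete_latticeI)
    fix S assume S: "S \<subseteq> carrier Q"
    then show "\<exists>s. least Q s (Upper Q S)" by (rule lub)
    obtain s where s: "least Q s (Upper Q (Lower Q S))"
      using lub[of "Lower Q S"] by auto
    have "greatest Q s (Lower Q S)"
    proof (rule greatest_LowerI)
      fix X assume X: "X \<in> S"
      show "s \<sqsubseteq>\<^bsub>Q\<^esub> X"
        by (rule least_le[OF s]) (use X S in \<open>auto simp: Upper_def Lower_def\<close>)
    next
      fix Y assume "Y \<in> Lower Q S"
      then show "Y \<sqsubseteq>\<^bsub>Q\<^esub> s" using s by (meson Lower_closed least_Upper_above)
    qed (use S s in auto)
    then show "\<exists>i. greatest Q i (Lower Q S)" by blast
  qed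
qed

lemma q_sup: assumes "A \<subseteq> carrier L" shows "q (\<Squnion>A) = \<Squnion>\<^bsub>Q\<^esub>(q ` A)"
proof -
  interpret Q: complete_lattice Q by (rule complete_lattice_Q)
  have "q ` A \<subseteq> carrier Q" using assms by auto
  then show ?thesis
    using Q.weak_least_unique[OF q_lub[OF assms] Q.sup_lub] Q.eq_is_equal by simp
qed

lemma q_meet:
  assumes x: "x \<in> carrier L" and y: "y \<in> carrier L"
  shows "q (x \<sqinter> y) = q x \<sqinter>\<^bsub>Q\<^esub> q y"
proof -
  interpret Q: complete_lattice Q by (rule complete_lattice_Q)
  show ?thesis
  proof (rule Q.meet_eqI[symmetric])
    fix U assume U: "U \<in> carrier Q" "U \<sqsubseteq>\<^bsub>Q\<^esub> q x" "U \<sqsubseteq>\<^bsub>Q\<^esub> q y"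
    then obtain u where u: "u \<in> carrier L" "U = q u" by (metis q_surj)
    have "(u \<sqinter> x, u) \<in> C" "(u \<sqinter> y, u) \<in> C"
      using U u x y q_le_iff by auto
    then have "((u \<sqinter> x) \<sqinter> y, u \<sqinter> y) \<in> C"
      using C_meet y q_eq_iff by blast
    then have "((u \<sqinter> x) \<sqinter> y, u) \<in> C"
      using \<open>(u \<sqinter> y, u) \<in> C\<close> by (rule C_trans)
    then show "U \<sqsubseteq>\<^bsub>Q\<^esub> q (x \<sqinter> y)"
      using u x y q_le_iff by (simp add: meet_assoc)
  qed (use x y in \<open>auto intro: q_mono meet_left meet_right\<close>)
qed

lemma q_top: "q \<top> = \<top>\<^bsub>Q\<^esub>"
proof -
  interpret Q: complete_lattice Q by (rule complete_lattice_Q)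
  show ?thesis
  proof (rule Q.top_eqI[symmetric])
    fix U assume "U \<in> carrier Q"
    then obtain u where "u \<in> carrier L" "U = q u" by (rule q_surj)
    then show "U \<sqsubseteq>\<^bsub>Q\<^esub> q \<top>" by (simp add: q_mono)
  qed simp
qed

lemma q_hom: "q \<in> frame_hom L Q"
proof (rule frame_homI)
  show "q \<in> extensional (carrier L)" by (simp add: quot_map_def)
qed (simp_all add: q_sup q_meet q_top)

lemma frame_Q: "frame Q"
proof -
  interpret Q: complete_lattice Q by (rule complete_lattice_Q)
  show ?thesis
  proof
    fix X S assume X: "X \<in> carrier Q" and S: "S \<subseteq> carrier Q"
    obtain x where x: "x \<in> carrier L" "X = q x" using X by (metis q_surj)
    define A where "A = {a \<in> carrier L. q a \<in> S}"
    have A: "A \<subseteq> carrier L" "S = q ` A"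
      using S by (auto simp: A_def elim!: q_surj)
    have "X \<sqinter>\<^bsub>Q\<^esub> \<Squnion>\<^bsub>Q\<^esub>S = q (x \<sqinter> \<Squnion>A)"
      using A x by (simp add: q_sup q_meet)
    also have "\<dots> = \<Squnion>\<^bsub>Q\<^esub>(q ` ((\<lambda>a. x \<sqinter> a) ` A))"
      using A x by (subst meet_sup_distrib, simp, simp) (rule q_sup, auto)
    also have "q ` ((\<lambda>a. x \<sqinter> a) ` A) = (\<lambda>Y. X \<sqinter>\<^bsub>Q\<^esub> Y) ` S"
      using A x by (auto simp: image_image q_meet subset_iff intro!: image_cong)
    finally show "X \<sqinter>\<^bsub>Q\<^esub> \<Squnion>\<^bsub>Q\<^esub>S = \<Squnion>\<^bsub>Q\<^esub>((\<lambda>Y. X \<sqinter>\<^bsub>Q\<^esub> Y) ` S)" .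
  qed
qed

lemma hom_kernel_quot_map: "hom_kernel L q = C"
  unfolding hom_kernel_def using q_eq_iff C_carrier by blast

lemma quot_factor:
  assumes "frame M" and f: "f \<in> frame_hom L M" and le: "C \<subseteq> hom_kernel L f"
  shows "\<exists>!g. g \<in> frame_hom Q M \<and> (\<forall>x \<in> carrier L. g (q x) = f x)"
proof (rule ex_ex1I)
  interpret M: frame M by fact
  interpret Q: frame Q by (rule frame_Q)
  define g where "g = (\<lambda>X \<in> carrier Q. f (SOME x. x \<in> carrier L \<and> q x = X))"
  have gq: "g (q x) = f x" if x: "x \<in> carrier L" for x
  proof -
    have "(SOME y. y \<in> carrier L \<and> q y = q x) \<in> carrier L \<and>
        q (SOME y. y \<in> carrier L \<and> q y = q x) = q x"
      by (rule someI[of _ x]) (use x in auto)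
    then have "((SOME y. y \<in> carrier L \<and> q y = q x), x) \<in> C"
      using x q_eq_iff by blast
    then show ?thesis
      using le x by (auto simp: g_def hom_kernel_def)
  qed
  have "g \<in> frame_hom Q M"
  proof (rule frame_homI)
    fix X assume "X \<in> carrier Q"
    then show "g X \<in> carrier M"
      using gq frame_homD(1)[OF f] by (metis q_surj)
  next
    fix S assume S: "S \<subseteq> carrier Q"
    define A where "A = {a \<in> carrier L. q a \<in> S}"
    have A: "A \<subseteq> carrier L" "S = q ` A"
      using S by (auto simp: A_def elim!: q_surj)
    have "g (\<Squnion>\<^bsub>Q\<^esub>S) = f (\<Squnion>A)"
      using A gq by (simp flip: q_sup)
    also have "\<dots> = \<Squnion>\<^bsub>M\<^esub>(f ` A)"
      using A frame_homD(2)[OF f] by blast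
    also have "f ` A = g ` S"
      using A gq by (auto simp: image_image subset_iff intro!: image_cong)
    finally show "g (\<Squnion>\<^bsub>Q\<^esub>S) = \<Squnion>\<^bsub>M\<^esub>(g ` S)" .
  next
    fix X Y assume "X \<in> carrier Q" "Y \<in> carrier Q"
    then obtain x y where "x \<in> carrier L" "y \<in> carrier L" "X = q x" "Y = q y"
      by (metis q_surj)
    then show "g (X \<sqinter>\<^bsub>Q\<^esub> Y) = g X \<sqinter>\<^bsub>M\<^esub> g Y"
      using gq frame_homD(3)[OF f] by (simp flip: q_meet)
  next
    show "g \<top>\<^bsub>Q\<^esub> = \<top>\<^bsub>M\<^esub>"
      using gq frame_homD(4)[OF f] by (simp flip: q_top)
  qed (auto simp: g_def)
  then show "\<exists>g. g \<in> frame_hom Q M \<and> (\<forall>x \<in> carrier L. g (q x) = f x)"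
    using gq by blast
next
  fix g h
  assume g: "g \<in> frame_hom Q M \<and> (\<forall>x \<in> carrier L. g (q x) = f x)"
    and h: "h \<in> frame_hom Q M \<and> (\<forall>x \<in> carrier L. h (q x) = f x)"
  show "g = h"
  proof (rule extensionalityI)
    show "g \<in> extensional (carrier Q)" "h \<in> extensional (carrier Q)"
      using g h frame_homD(5) by blast+
    fix X assume "X \<in> carrier Q"
    then obtain x where "x \<in> carrier L" "X = q x" by (rule q_surj)
    then show "g X = h X" using g h by simp
  qed
qed

end

lemma frame_congruence_hom_kernel:
  assumes "frame L" "frame M" and f: "f \<in> frame_hom L M"
  shows "frame_congruence L (hom_kernel L f)"
proof -
  interpret L: frame L by fact
  interpret M: frame M by fact
  show ?thesis
    unfolding frame_congruence_def
  proof (intro conjI allI impI)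
    show "equiv (carrier L) (hom_kernel L f)"
      by (auto simp: equiv_def refl_on_def sym_def trans_def hom_kernel_def)
  next
    fix S assume S: "S \<subseteq> hom_kernel L f"
    then have c: "fst ` S \<subseteq> carrier L" "snd ` S \<subseteq> carrier L"
      by (auto simp: hom_kernel_def)
    have "f ` fst ` S = f ` snd ` S"
      using S by (force simp: hom_kernel_def image_image intro!: image_cong)
    then show "(\<Squnion>\<^bsub>L\<^esub>(fst ` S), \<Squnion>\<^bsub>L\<^esub>(snd ` S)) \<in> hom_kernel L f"
      using c frame_homD(2)[OF f] by (simp add: hom_kernel_def)
  next
    show "\<forall>(x, y) \<in> hom_kernel L f. \<forall>(x', y') \<in> hom_kernel L f.
        (x \<sqinter>\<^bsub>L\<^esub> x', y \<sqinter>\<^bsub>L\<^esub> y') \<in> hom_kernel L f"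
      using frame_homD(3)[OF f] by (auto simp: hom_kernel_def)
  qed
qed

theorem quot_gen_congruence:
  assumes "frame L" and R: "R \<subseteq> carrier L \<times> carrier L"
  shows "frame (quot_frame L (gen_congruence L R))"
    and "quot_map L (gen_congruence L R) \<in> frame_hom L (quot_frame L (gen_congruence L R))"
    and "\<And>a b. (a, b) \<in> R \<Longrightarrow> quot_map L (gen_congruence L R) a
      \<sqsubseteq>\<^bsub>quot_frame L (gen_congruence L R)\<^esub> quot_map L (gen_congruence L R) b"
    and "hom_kernel L (quot_map L (gen_congruence L R)) = gen_congruence L R"
proof -
  interpret frame_with_congruence L "gen_congruence L R"
    using frame_congruence_gen(1)[OF assms] assms(1)
    by (simp add: frame_with_congruence_def frame_with_congruence_axioms_def)
  show "frame Q" by (rule frame_Q)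
  show "q \<in> frame_hom L Q" by (rule q_hom)
  show "q a \<sqsubseteq>\<^bsub>Q\<^esub> q b" if "(a, b) \<in> R" for a b
    using q_le_iff frame_congruence_gen(2)[OF assms that] R that by auto
  show "hom_kernel L q = gen_congruence L R" by (rule hom_kernel_quot_map)
qed

theorem quot_gen_congruence_universal:
  assumes "frame L" and R: "R \<subseteq> carrier L \<times> carrier L" and "frame M"
    and f: "f \<in> frame_hom L M" and le: "\<And>a b. (a, b) \<in> R \<Longrightarrow> f a \<sqsubseteq>\<^bsub>M\<^esub> f b"
  shows "\<exists>!g. g \<in> frame_hom (quot_frame L (gen_congruence L R)) M \<and>
    (\<forall>x \<in> carrier L. g (quot_map L (gen_congruence L R) x) = f x)"
proof -
  interpret frame_with_congruence L "gen_congruence L R"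
    using frame_congruence_gen(1)[OF assms(1,2)] assms(1)
    by (simp add: frame_with_congruence_def frame_with_congruence_axioms_def)
  interpret M: frame M by fact
  have "(a \<sqinter>\<^bsub>L\<^esub> b, a) \<in> hom_kernel L f" if "(a, b) \<in> R" for a b
  proof -
    have "a \<in> carrier L" "b \<in> carrier L" using that R by auto
    then show ?thesis
      using le[OF that] M.le_iff_meet_eq frame_homD(1,3)[OF f] by (auto simp: hom_kernel_def)
  qed
  then have "gen_congruence L R \<subseteq> hom_kernel L f"
    using frame_congruence_hom_kernel[OF assms(1,3) f] unfolding gen_congruence_def by blast
  then show ?thesis
    using quot_factor[OF assms(3) f] by blast
qed


section \<open>Coproducts of frames\<close>

text \<open>The coproduct is realised by the C-ideals of the product: downward closed sets that are
  closed under joins (in particular under the empty join) in each coordinate separately. It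
  is characterised by \<open>coprod_universal\<close>.\<close>

definition cideals ::
    "('a, 'c) gorder_scheme \<Rightarrow> ('b, 'd) gorder_scheme \<Rightarrow> ('a \<times> 'b) set set" where
  "cideals L M = {U. U \<subseteq> carrier L \<times> carrier M \<and>
     (\<forall>(x, y) \<in> U. \<forall>x' \<in> carrier L. \<forall>y' \<in> carrier M.
        x' \<sqsubseteq>\<^bsub>L\<^esub> x \<longrightarrow> y' \<sqsubseteq>\<^bsub>M\<^esub> y \<longrightarrow> (x', y') \<in> U) \<and>
     (\<forall>A b. A \<subseteq> carrier L \<longrightarrow> b \<in> carrier M \<longrightarrow> A \<times> {b} \<subseteq> U \<longrightarrow> (\<Squnion>\<^bsub>L\<^esub>A, b) \<in> U) \<and>
     (\<forall>a B. a \<in> carrier L \<longrightarrow> B \<subseteq> carrier M \<longrightarrow> {a} \<times> B \<subseteq> U \<longrightarrow> (a, \<Squnion>\<^bsub>M\<^esub>B) \<in> U)}"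

definition coprod ::
    "('a, 'c) gorder_scheme \<Rightarrow> ('b, 'd) gorder_scheme \<Rightarrow> ('a \<times> 'b) set gorder" where
  "coprod L M = \<lparr>carrier = cideals L M, eq = (=), le = (\<subseteq>)\<rparr>"

definition coprod_in1 ::
    "('a, 'c) gorder_scheme \<Rightarrow> ('b, 'd) gorder_scheme \<Rightarrow> 'a \<Rightarrow> ('a \<times> 'b) set" where
  "coprod_in1 L M =
     (\<lambda>a \<in> carrier L. {(x, y) \<in> carrier L \<times> carrier M. x \<sqsubseteq>\<^bsub>L\<^esub> a \<or> y = \<bottom>\<^bsub>M\<^esub>})"

definition coprod_in2 ::
    "('a, 'c) gorder_scheme \<Rightarrow> ('b, 'd) gorder_scheme \<Rightarrow> 'b \<Rightarrow> ('a \<times> 'b) set" where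
  "coprod_in2 L M =
     (\<lambda>b \<in> carrier M. {(x, y) \<in> carrier L \<times> carrier M. y \<sqsubseteq>\<^bsub>M\<^esub> b \<or> x = \<bottom>\<^bsub>L\<^esub>})"

locale frame_pair = L: frame L + M: frame M
  for L :: "('a, 'c) gorder_scheme" and M :: "('b, 'd) gorder_scheme"
begin

abbreviation "P \<equiv> coprod L M"
abbreviation "in1 \<equiv> coprod_in1 L M"
abbreviation "in2 \<equiv> coprod_in2 L M"

lemma P_simps [simp]: "carrier P = cideals L M" "(\<sqsubseteq>\<^bsub>P\<^esub>) = (\<subseteq>)" "(.=\<^bsub>P\<^esub>) = (=)"
  by (simp_all add: coprod_def)

lemma cidealsI:
  assumes "U \<subseteq> carrier L \<times> carrier M"
    and "\<And>x y x' y'. (x, y) \<in> U \<Longrightarrow> x' \<in> carrier L \<Longrightarrow> y' \<in> carrier M \<Longrightarrow>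
      x' \<sqsubseteq>\<^bsub>L\<^esub> x \<Longrightarrow> y' \<sqsubseteq>\<^bsub>M\<^esub> y \<Longrightarrow> (x', y') \<in> U"
    and "\<And>A b. A \<subseteq> carrier L \<Longrightarrow> b \<in> carrier M \<Longrightarrow> (\<And>a. a \<in> A \<Longrightarrow> (a, b) \<in> U) \<Longrightarrow>
      (\<Squnion>\<^bsub>L\<^esub>A, b) \<in> U"
    and "\<And>a B. a \<in> carrier L \<Longrightarrow> B \<subseteq> carrier M \<Longrightarrow> (\<And>b. b \<in> B \<Longrightarrow> (a, b) \<in> U) \<Longrightarrow>
      (a, \<Squnion>\<^bsub>M\<^esub>B) \<in> U"
  shows "U \<in> cideals L M"
  unfolding cideals_def mem_Collect_eq
proof (intro conjI allI impI)
  show "\<forall>(x, y) \<in> U. \<forall>x' \<in> carrier L. \<forall>y' \<in> carrier M.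
      x' \<sqsubseteq>\<^bsub>L\<^esub> x \<longrightarrow> y' \<sqsubseteq>\<^bsub>M\<^esub> y \<longrightarrow> (x', y') \<in> U"
    using assms(2) by auto
next
  fix A b assume "A \<subseteq> carrier L" "b \<in> carrier M" "A \<times> {b} \<subseteq> U"
  then show "(\<Squnion>\<^bsub>L\<^esub>A, b) \<in> U" by (intro assms(3)) auto
next
  fix a B assume "a \<in> carrier L" "B \<subseteq> carrier M" "{a} \<times> B \<subseteq> U"
  then show "(a, \<Squnion>\<^bsub>M\<^esub>B) \<in> U" by (intro assms(4)) auto
qed (rule assms(1))

lemma cidealsD:
  assumes "U \<in> cideals L M"
  shows "U \<subseteq> carrier L \<times> carrier M"
    and "\<And>x y x' y'. (x, y) \<in> U \<Longrightarrow> x' \<in> carrier L \<Longrightarrow> y' \<in> carrier M \<Longrightarrow>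
      x' \<sqsubseteq>\<^bsub>L\<^esub> x \<Longrightarrow> y' \<sqsubseteq>\<^bsub>M\<^esub> y \<Longrightarrow> (x', y') \<in> U"
    and "\<And>A b. A \<subseteq> carrier L \<Longrightarrow> b \<in> carrier M \<Longrightarrow> (\<And>a. a \<in> A \<Longrightarrow> (a, b) \<in> U) \<Longrightarrow>
      (\<Squnion>\<^bsub>L\<^esub>A, b) \<in> U"
    and "\<And>a B. a \<in> carrier L \<Longrightarrow> B \<subseteq> carrier M \<Longrightarrow> (\<And>b. b \<in> B \<Longrightarrow> (a, b) \<in> U) \<Longrightarrow>
      (a, \<Squnion>\<^bsub>M\<^esub>B) \<in> U"
proof -
  note U = assms[unfolded cideals_def mem_Collect_eq]
  note * = U[THEN conjunct1] U[THEN conjunct2, THEN conjunct1]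
    U[THEN conjunct2, THEN conjunct2, THEN conjunct1]
    U[THEN conjunct2, THEN conjunct2, THEN conjunct2]
  show "U \<subseteq> carrier L \<times> carrier M" by (rule *(1))
  show "(x', y') \<in> U"
    if "(x, y) \<in> U" "x' \<in> carrier L" "y' \<in> carrier M" "x' \<sqsubseteq>\<^bsub>L\<^esub> x" "y' \<sqsubseteq>\<^bsub>M\<^esub> y" for x y x' y'
    using bspec[OF *(2) that(1)] that(2-) by simp
  show "(\<Squnion>\<^bsub>L\<^esub>A, b) \<in> U"
    if "A \<subseteq> carrier L" "b \<in> carrier M" "\<And>a. a \<in> A \<Longrightarrow> (a, b) \<in> U" for A b
    using *(3)[rule_format, OF that(1,2)] that(3) by auto
  show "(a, \<Squnion>\<^bsub>M\<^esub>B) \<in> U"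
    if "a \<in> carrier L" "B \<subseteq> carrier M" "\<And>b. b \<in> B \<Longrightarrow> (a, b) \<in> U" for a B
    using *(4)[rule_format, OF that(1,2)] that(3) by auto
qed

lemma cideal_bot:
  assumes U: "U \<in> cideals L M"
  shows "y \<in> carrier M \<Longrightarrow> (\<bottom>\<^bsub>L\<^esub>, y) \<in> U" and "x \<in> carrier L \<Longrightarrow> (x, \<bottom>\<^bsub>M\<^esub>) \<in> U"
proof -
  have [simp]: "\<Squnion>\<^bsub>L\<^esub>{} = \<bottom>\<^bsub>L\<^esub>" "\<Squnion>\<^bsub>M\<^esub>{} = \<bottom>\<^bsub>M\<^esub>"
    using L.weak_sup_empty M.weak_sup_empty L.eq_is_equal M.eq_is_equal by simp_all
  show "y \<in> carrier M \<Longrightarrow> (\<bottom>\<^bsub>L\<^esub>, y) \<in> U" using cidealsD(3)[OF U, of "{}"] by simp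
  show "x \<in> carrier L \<Longrightarrow> (x, \<bottom>\<^bsub>M\<^esub>) \<in> U" using cidealsD(4)[OF U, of _ "{}"] by simp
qed

lemma cideals_full: "carrier L \<times> carrier M \<in> cideals L M"
  by (rule cidealsI) auto

lemma cideals_Inter:
  assumes "K \<noteq> {}" "K \<subseteq> cideals L M"
  shows "\<Inter>K \<in> cideals L M"
proof (rule cidealsI)
  show "\<Inter>K \<subseteq> carrier L \<times> carrier M" using assms cidealsD(1) by blast
next
  fix x y x' y'
  assume "(x, y) \<in> \<Inter>K" "x' \<in> carrier L" "y' \<in> carrier M" "x' \<sqsubseteq>\<^bsub>L\<^esub> x" "y' \<sqsubseteq>\<^bsub>M\<^esub> y"
  then show "(x', y') \<in> \<Inter>K"
    using assms(2) by (auto intro: cidealsD(2))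
next
  fix A b assume "A \<subseteq> carrier L" "b \<in> carrier M" "\<And>a. a \<in> A \<Longrightarrow> (a, b) \<in> \<Inter>K"
  then show "(\<Squnion>\<^bsub>L\<^esub>A, b) \<in> \<Inter>K"
    using assms(2) by (auto intro!: cidealsD(3))
next
  fix a B assume "a \<in> carrier L" "B \<subseteq> carrier M" "\<And>b. b \<in> B \<Longrightarrow> (a, b) \<in> \<Inter>K"
  then show "(a, \<Squnion>\<^bsub>M\<^esub>B) \<in> \<Inter>K"
    using assms(2) by (auto intro!: cidealsD(4))
qed

lemma cideals_Int: "\<lbrakk>U \<in> cideals L M; V \<in> cideals L M\<rbrakk> \<Longrightarrow> U \<inter> V \<in> cideals L M"
  using cideals_Inter[of "{U, V}"] by simp

lemma complete_lattice_P: "complete_lattice P"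
proof -
  interpret P: partial_order P
    by standard auto
  show ?thesis
  proof (rule P.complete_lattice_criterion1)
    have "greatest P (carrier L \<times> carrier M) (carrier P)"
      using cideals_full cidealsD(1) by (auto simp: greatest_def)
    then show "\<exists>g. greatest P g (carrier P)" ..
  next
    fix K assume K: "K \<subseteq> carrier P" "K \<noteq> {}"
    have "greatest P (\<Inter>K) (Lower P K)"
      by (rule greatest_LowerI) (use K cideals_Inter in \<open>auto simp: Lower_def\<close>)
    then show "\<exists>i. greatest P i (Lower P K)" ..
  qed
qed

lemma P_meet: "\<lbrakk>U \<in> cideals L M; V \<in> cideals L M\<rbrakk> \<Longrightarrow> U \<sqinter>\<^bsub>P\<^esub> V = U \<inter> V"
  by (rule complete_lattice.meet_eqI[OF complete_lattice_P]) (auto simp: cideals_Int)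

lemma P_top: "\<top>\<^bsub>P\<^esub> = carrier L \<times> carrier M"
  by (rule complete_lattice.top_eqI[OF complete_lattice_P]) (use cideals_full cidealsD(1) in auto)

lemma P_sup_upper: "\<lbrakk>K \<subseteq> cideals L M; U \<in> K\<rbrakk> \<Longrightarrow> U \<subseteq> \<Squnion>\<^bsub>P\<^esub>K"
proof -
  interpret P: complete_lattice P by (rule complete_lattice_P)
  show "K \<subseteq> cideals L M \<Longrightarrow> U \<in> K \<Longrightarrow> U \<subseteq> \<Squnion>\<^bsub>P\<^esub>K" using P.sup_upper by simp
qed

lemma P_sup_least:
  "\<lbrakk>K \<subseteq> cideals L M; W \<in> cideals L M; \<And>U. U \<in> K \<Longrightarrow> U \<subseteq> W\<rbrakk> \<Longrightarrow> \<Squnion>\<^bsub>P\<^esub>K \<subseteq> W"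
proof -
  interpret P: complete_lattice P by (rule complete_lattice_P)
  show "\<lbrakk>K \<subseteq> cideals L M; W \<in> cideals L M; \<And>U. U \<in> K \<Longrightarrow> U \<subseteq> W\<rbrakk> \<Longrightarrow> \<Squnion>\<^bsub>P\<^esub>K \<subseteq> W"
    using P.sup_least by simp
qed

lemma P_sup_closed: "K \<subseteq> cideals L M \<Longrightarrow> \<Squnion>\<^bsub>P\<^esub>K \<in> cideals L M"
proof -
  interpret P: complete_lattice P by (rule complete_lattice_P)
  show "K \<subseteq> cideals L M \<Longrightarrow> \<Squnion>\<^bsub>P\<^esub>K \<in> cideals L M" using P.sup_closed by simp
qed

lemma cideals_imp:
  assumes U: "U \<in> cideals L M" and W: "W \<in> cideals L M"
  shows "{(x, y) \<in> carrier L \<times> carrier M. \<forall>(u, v) \<in> U. (x \<sqinter>\<^bsub>L\<^esub> u, y \<sqinter>\<^bsub>M\<^esub> v) \<in> W} \<in> cideals L M"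
    (is "?I \<in> _")
proof -
  have II: "(x, y) \<in> ?I" if "x \<in> carrier L" "y \<in> carrier M"
      "\<And>u v. (u, v) \<in> U \<Longrightarrow> (x \<sqinter>\<^bsub>L\<^esub> u, y \<sqinter>\<^bsub>M\<^esub> v) \<in> W" for x y
    using that by auto
  have ID: "(x \<sqinter>\<^bsub>L\<^esub> u, y \<sqinter>\<^bsub>M\<^esub> v) \<in> W" if "(x, y) \<in> ?I" "(u, v) \<in> U" for x y u v
  proof -
    have "\<forall>(u, v) \<in> U. (x \<sqinter>\<^bsub>L\<^esub> u, y \<sqinter>\<^bsub>M\<^esub> v) \<in> W" using that(1) by simp
    from bspec[OF this that(2)] show ?thesis by simp
  qed
  have Uc: "u \<in> carrier L" "v \<in> carrier M" if "(u, v) \<in> U" for u v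
    using that cidealsD(1)[OF U] by auto
  show ?thesis
  proof (rule cidealsI)
    show "?I \<subseteq> carrier L \<times> carrier M" by blast
  next
    fix x y x' y'
    assume *: "(x, y) \<in> ?I" "x' \<in> carrier L" "y' \<in> carrier M" "x' \<sqsubseteq>\<^bsub>L\<^esub> x" "y' \<sqsubseteq>\<^bsub>M\<^esub> y"
    have "(x' \<sqinter>\<^bsub>L\<^esub> u, y' \<sqinter>\<^bsub>M\<^esub> v) \<in> W" if uv: "(u, v) \<in> U" for u v
    proof (rule cidealsD(2)[OF W])
      have c: "x \<in> carrier L" "y \<in> carrier M" using *(1) by simp_all
      show "(x \<sqinter>\<^bsub>L\<^esub> u, y \<sqinter>\<^bsub>M\<^esub> v) \<in> W" by (rule ID[OF *(1) uv])
      show "x' \<sqinter>\<^bsub>L\<^esub> u \<sqsubseteq>\<^bsub>L\<^esub> x \<sqinter>\<^bsub>L\<^esub> u"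
        using * c Uc[OF uv]
        by (intro L.meet_le L.meet_right L.le_trans[OF L.meet_left]) auto
      show "y' \<sqinter>\<^bsub>M\<^esub> v \<sqsubseteq>\<^bsub>M\<^esub> y \<sqinter>\<^bsub>M\<^esub> v"
        using * c Uc[OF uv]
        by (intro M.meet_le M.meet_right M.le_trans[OF M.meet_left]) auto
    qed (use * Uc[OF uv] in auto)
    then show "(x', y') \<in> ?I" by (rule II[OF *(2,3)])
  next
    fix A b assume *: "A \<subseteq> carrier L" "b \<in> carrier M" "\<And>a. a \<in> A \<Longrightarrow> (a, b) \<in> ?I"
    have "(\<Squnion>\<^bsub>L\<^esub>A \<sqinter>\<^bsub>L\<^esub> u, b \<sqinter>\<^bsub>M\<^esub> v) \<in> W" if uv: "(u, v) \<in> U" for u v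
    proof -
      have "(\<Squnion>\<^bsub>L\<^esub>((\<lambda>a. u \<sqinter>\<^bsub>L\<^esub> a) ` A), b \<sqinter>\<^bsub>M\<^esub> v) \<in> W"
      proof (rule cidealsD(3)[OF W])
        fix a' assume "a' \<in> (\<lambda>a. u \<sqinter>\<^bsub>L\<^esub> a) ` A"
        then obtain a where a: "a \<in> A" "a' = u \<sqinter>\<^bsub>L\<^esub> a" by blast
        have "(a \<sqinter>\<^bsub>L\<^esub> u, b \<sqinter>\<^bsub>M\<^esub> v) \<in> W" by (rule ID[OF *(3)[OF a(1)] uv])
        then show "(a', b \<sqinter>\<^bsub>M\<^esub> v) \<in> W" unfolding a(2) meet_comm[of L u a] .
      qed (use * Uc[OF uv] in auto)
      then show ?thesis
        unfolding L.meet_sup_distrib[OF Uc(1)[OF uv] *(1), symmetric] meet_comm[of L u "\<Squnion>\<^bsub>L\<^esub>A"] .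
    qed
    then show "(\<Squnion>\<^bsub>L\<^esub>A, b) \<in> ?I" by (rule II[OF L.sup_closed[OF *(1)] *(2)])
  next
    fix a B assume *: "a \<in> carrier L" "B \<subseteq> carrier M" "\<And>b. b \<in> B \<Longrightarrow> (a, b) \<in> ?I"
    have "(a \<sqinter>\<^bsub>L\<^esub> u, \<Squnion>\<^bsub>M\<^esub>B \<sqinter>\<^bsub>M\<^esub> v) \<in> W" if uv: "(u, v) \<in> U" for u v
    proof -
      have "(a \<sqinter>\<^bsub>L\<^esub> u, \<Squnion>\<^bsub>M\<^esub>((\<lambda>b. v \<sqinter>\<^bsub>M\<^esub> b) ` B)) \<in> W"
      proof (rule cidealsD(4)[OF W])
        fix b' assume "b' \<in> (\<lambda>b. v \<sqinter>\<^bsub>M\<^esub> b) ` B"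
        then obtain b where b: "b \<in> B" "b' = v \<sqinter>\<^bsub>M\<^esub> b" by blast
        have "(a \<sqinter>\<^bsub>L\<^esub> u, b \<sqinter>\<^bsub>M\<^esub> v) \<in> W" by (rule ID[OF *(3)[OF b(1)] uv])
        then show "(a \<sqinter>\<^bsub>L\<^esub> u, b') \<in> W" unfolding b(2) meet_comm[of M v b] .
      qed (use * Uc[OF uv] in auto)
      then show ?thesis
        unfolding M.meet_sup_distrib[OF Uc(2)[OF uv] *(2), symmetric] meet_comm[of M v "\<Squnion>\<^bsub>M\<^esub>B"] .
    qed
    then show "(a, \<Squnion>\<^bsub>M\<^esub>B) \<in> ?I" by (rule II[OF *(1) M.sup_closed[OF *(2)]])
  qed
qed

lemma frame_P: "frame P"
proof -
  interpret P: complete_lattice P by (rule complete_lattice_P)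
  show ?thesis
  proof
    fix U K assume "U \<in> carrier P" "K \<subseteq> carrier P"
    then have U: "U \<in> cideals L M" and K: "K \<subseteq> cideals L M" by auto
    have UK: "(\<lambda>V. U \<sqinter>\<^bsub>P\<^esub> V) ` K \<subseteq> cideals L M"
      using U K P_meet cideals_Int by auto
    define W where "W = \<Squnion>\<^bsub>P\<^esub>((\<lambda>V. U \<sqinter>\<^bsub>P\<^esub> V) ` K)"
    define I where "I = {(x, y) \<in> carrier L \<times> carrier M. \<forall>(u, v) \<in> U. (x \<sqinter>\<^bsub>L\<^esub> u, y \<sqinter>\<^bsub>M\<^esub> v) \<in> W}"
    have W: "W \<in> cideals L M" unfolding W_def by (rule P_sup_closed[OF UK])
    have I: "I \<in> cideals L M" unfolding I_def by (rule cideals_imp[OF U W])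
    have Uc: "u \<in> carrier L" "v \<in> carrier M" if "(u, v) \<in> U" for u v
      using that cidealsD(1)[OF U] by auto
    have "V \<subseteq> I" if V: "V \<in> K" for V
    proof
      fix p assume "p \<in> V"
      moreover obtain x y where p: "p = (x, y)" by (cases p)
      ultimately have xy: "(x, y) \<in> V" "x \<in> carrier L" "y \<in> carrier M"
        using V K cidealsD(1) by blast+
      have "(x \<sqinter>\<^bsub>L\<^esub> u, y \<sqinter>\<^bsub>M\<^esub> v) \<in> W" if uv: "(u, v) \<in> U" for u v
      proof -
        have "(x \<sqinter>\<^bsub>L\<^esub> u, y \<sqinter>\<^bsub>M\<^esub> v) \<in> U"
          by (rule cidealsD(2)[OF U uv])
            (use xy Uc[OF uv] in \<open>auto intro: L.meet_right M.meet_right\<close>)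
        moreover have "(x \<sqinter>\<^bsub>L\<^esub> u, y \<sqinter>\<^bsub>M\<^esub> v) \<in> V"
          by (rule cidealsD(2)[OF _ xy(1)])
            (use xy V K Uc[OF uv] in \<open>auto intro: L.meet_left M.meet_left\<close>)
        moreover have "U \<inter> V \<subseteq> W"
          using P_sup_upper[OF UK, of "U \<sqinter>\<^bsub>P\<^esub> V"] P_meet U K V unfolding W_def by auto
        ultimately show ?thesis by blast
      qed
      then show "p \<in> I" unfolding I_def p using xy by auto
    qed
    then have "\<Squnion>\<^bsub>P\<^esub>K \<subseteq> I" using P_sup_least[OF K I] by blast
    then have "p \<in> W" if "p \<in> U" "p \<in> \<Squnion>\<^bsub>P\<^esub>K" for p
    proof -
      obtain x y where p: "p = (x, y)" by (cases p)
      have xy: "(x, y) \<in> I" "(x, y) \<in> U" using that p \<open>\<Squnion>\<^bsub>P\<^esub>K \<subseteq> I\<close> by auto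
      then have "\<forall>(u, v) \<in> U. (x \<sqinter>\<^bsub>L\<^esub> u, y \<sqinter>\<^bsub>M\<^esub> v) \<in> W" unfolding I_def by simp
      from bspec[OF this xy(2)] have "(x \<sqinter>\<^bsub>L\<^esub> x, y \<sqinter>\<^bsub>M\<^esub> y) \<in> W" by simp
      then show ?thesis
        using Uc[OF xy(2)] L.le_iff_meet_eq M.le_iff_meet_eq L.le_refl M.le_refl p by metis
    qed
    then have "U \<inter> \<Squnion>\<^bsub>P\<^esub>K \<subseteq> W" by blast
    moreover have "W \<subseteq> U \<inter> \<Squnion>\<^bsub>P\<^esub>K"
      unfolding W_def
    proof (rule P_sup_least[OF UK cideals_Int[OF U P_sup_closed[OF K]]])
      fix V assume "V \<in> (\<lambda>V. U \<sqinter>\<^bsub>P\<^esub> V) ` K"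
      then obtain V' where "V' \<in> K" "V = U \<inter> V'" using P_meet U K by auto
      then show "V \<subseteq> U \<inter> \<Squnion>\<^bsub>P\<^esub>K" using P_sup_upper[OF K] by blast
    qed
    ultimately show "U \<sqinter>\<^bsub>P\<^esub> \<Squnion>\<^bsub>P\<^esub>K = \<Squnion>\<^bsub>P\<^esub>((\<lambda>V. U \<sqinter>\<^bsub>P\<^esub> V) ` K)"
      using P_meet[OF U P_sup_closed[OF K]] unfolding W_def by blast
  qed
qed

definition rect :: "'a \<Rightarrow> 'b \<Rightarrow> ('a \<times> 'b) set" where
  "rect a b = {(x, y) \<in> carrier L \<times> carrier M.
     (x \<sqsubseteq>\<^bsub>L\<^esub> a \<and> y \<sqsubseteq>\<^bsub>M\<^esub> b) \<or> x = \<bottom>\<^bsub>L\<^esub> \<or> y = \<bottom>\<^bsub>M\<^esub>}"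

lemma le_bot1: "\<lbrakk>x \<in> carrier L; x \<sqsubseteq>\<^bsub>L\<^esub> \<bottom>\<^bsub>L\<^esub>\<rbrakk> \<Longrightarrow> x = \<bottom>\<^bsub>L\<^esub>"
  by (rule L.le_antisym) auto

lemma le_bot2: "\<lbrakk>x \<in> carrier M; x \<sqsubseteq>\<^bsub>M\<^esub> \<bottom>\<^bsub>M\<^esub>\<rbrakk> \<Longrightarrow> x = \<bottom>\<^bsub>M\<^esub>"
  by (rule M.le_antisym) auto

lemma rect_cideal:
  assumes a: "a \<in> carrier L" and b: "b \<in> carrier M"
  shows "rect a b \<in> cideals L M"
proof (rule cidealsI)
  fix x y x' y'
  assume *: "(x, y) \<in> rect a b" "x' \<in> carrier L" "y' \<in> carrier M" "x' \<sqsubseteq>\<^bsub>L\<^esub> x" "y' \<sqsubseteq>\<^bsub>M\<^esub> y"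
  then consider "x \<sqsubseteq>\<^bsub>L\<^esub> a" "y \<sqsubseteq>\<^bsub>M\<^esub> b" "x \<in> carrier L" "y \<in> carrier M"
    | "x' = \<bottom>\<^bsub>L\<^esub>" | "y' = \<bottom>\<^bsub>M\<^esub>"
    using le_bot1 le_bot2 by (auto simp: rect_def)
  then show "(x', y') \<in> rect a b"
  proof cases
    case 1
    then show ?thesis
      using * a b L.le_trans[of x' x a] M.le_trans[of y' y b] by (simp add: rect_def)
  qed (use * in \<open>auto simp: rect_def\<close>)
next
  fix A c assume *: "A \<subseteq> carrier L" "c \<in> carrier M" "\<And>x. x \<in> A \<Longrightarrow> (x, c) \<in> rect a b"
  show "(\<Squnion>\<^bsub>L\<^esub>A, c) \<in> rect a b"
  proof (cases "c = \<bottom>\<^bsub>M\<^esub> \<or> (\<forall>x \<in> A. x = \<bottom>\<^bsub>L\<^esub>)")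
    case True
    moreover have "\<Squnion>\<^bsub>L\<^esub>A = \<bottom>\<^bsub>L\<^esub>" if "\<forall>x \<in> A. x = \<bottom>\<^bsub>L\<^esub>"
      by (rule L.sup_eqI) (use that *(1) in auto)
    ultimately show ?thesis using * by (auto simp: rect_def)
  next
    case False
    then have "c \<sqsubseteq>\<^bsub>M\<^esub> b" "\<And>x. x \<in> A \<Longrightarrow> x \<sqsubseteq>\<^bsub>L\<^esub> a"
      using *(3) a by (auto simp: rect_def)
    then show ?thesis using * a L.sup_least by (simp add: rect_def)
  qed
next
  fix c B assume *: "c \<in> carrier L" "B \<subseteq> carrier M" "\<And>y. y \<in> B \<Longrightarrow> (c, y) \<in> rect a b"
  show "(c, \<Squnion>\<^bsub>M\<^esub>B) \<in> rect a b"
  proof (cases "c = \<bottom>\<^bsub>L\<^esub> \<or> (\<forall>y \<in> B. y = \<bottom>\<^bsub>M\<^esub>)")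
    case True
    moreover have "\<Squnion>\<^bsub>M\<^esub>B = \<bottom>\<^bsub>M\<^esub>" if "\<forall>y \<in> B. y = \<bottom>\<^bsub>M\<^esub>"
      by (rule M.sup_eqI) (use that *(2) in auto)
    ultimately show ?thesis using * by (auto simp: rect_def)
  next
    case False
    then have "c \<sqsubseteq>\<^bsub>L\<^esub> a" "\<And>y. y \<in> B \<Longrightarrow> y \<sqsubseteq>\<^bsub>M\<^esub> b"
      using *(3) b by (auto simp: rect_def)
    then show ?thesis using * b M.sup_least by (simp add: rect_def)
  qed
qed (auto simp: rect_def)

lemma rect_le_iff:
  assumes a: "a \<in> carrier L" and b: "b \<in> carrier M" and U: "U \<in> cideals L M"
  shows "rect a b \<subseteq> U \<longleftrightarrow> (a, b) \<in> U"
proof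
  assume "rect a b \<subseteq> U"
  then show "(a, b) \<in> U" using a b by (auto simp: rect_def)
next
  assume ab: "(a, b) \<in> U"
  show "rect a b \<subseteq> U"
  proof
    fix p assume "p \<in> rect a b"
    then show "p \<in> U"
      using cidealsD(2)[OF U ab] cideal_bot[OF U] by (auto simp: rect_def)
  qed
qed

lemma in1_rect: "a \<in> carrier L \<Longrightarrow> in1 a = rect a \<top>\<^bsub>M\<^esub>"
  by (auto simp: coprod_in1_def rect_def)

lemma in2_rect: "b \<in> carrier M \<Longrightarrow> in2 b = rect \<top>\<^bsub>L\<^esub> b"
  by (auto simp: coprod_in2_def rect_def)

lemma in1_closed: "a \<in> carrier L \<Longrightarrow> in1 a \<in> cideals L M"
  by (simp add: in1_rect rect_cideal)

lemma in2_closed: "b \<in> carrier M \<Longrightarrow> in2 b \<in> cideals L M"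
  by (simp add: in2_rect rect_cideal)

lemma in1_meet_in2:
  assumes "a \<in> carrier L" "b \<in> carrier M"
  shows "in1 a \<sqinter>\<^bsub>P\<^esub> in2 b = rect a b"
  using assms by (subst P_meet) (auto simp: in1_rect in2_rect rect_cideal, auto simp: rect_def)

lemma le_meet_iff1:
  "\<lbrakk>x \<in> carrier L; a \<in> carrier L; b \<in> carrier L\<rbrakk> \<Longrightarrow>
    x \<sqsubseteq>\<^bsub>L\<^esub> a \<sqinter>\<^bsub>L\<^esub> b \<longleftrightarrow> x \<sqsubseteq>\<^bsub>L\<^esub> a \<and> x \<sqsubseteq>\<^bsub>L\<^esub> b"
  by (meson L.le_trans L.meet_closed L.meet_le L.meet_left L.meet_right)

lemma le_meet_iff2:
  "\<lbrakk>x \<in> carrier M; a \<in> carrier M; b \<in> carrier M\<rbrakk> \<Longrightarrow>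
    x \<sqsubseteq>\<^bsub>M\<^esub> a \<sqinter>\<^bsub>M\<^esub> b \<longleftrightarrow> x \<sqsubseteq>\<^bsub>M\<^esub> a \<and> x \<sqsubseteq>\<^bsub>M\<^esub> b"
  by (meson M.le_trans M.meet_closed M.meet_le M.meet_left M.meet_right)

lemma in1_hom: "in1 \<in> frame_hom L P"
proof (rule frame_homI)
  interpret P: complete_lattice P by (rule complete_lattice_P)
  fix A assume A: "A \<subseteq> carrier L"
  show "in1 (\<Squnion>\<^bsub>L\<^esub>A) = \<Squnion>\<^bsub>P\<^esub>(in1 ` A)"
  proof (rule P.sup_eqI[symmetric])
    fix X assume "X \<in> in1 ` A"
    then obtain a where a: "a \<in> A" "X = in1 a" by blast
    then have "X = rect a \<top>\<^bsub>M\<^esub>" "a \<in> carrier L" "a \<sqsubseteq>\<^bsub>L\<^esub> \<Squnion>\<^bsub>L\<^esub>A"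
      using A in1_rect L.sup_upper by auto
    then show "X \<sqsubseteq>\<^bsub>P\<^esub> in1 (\<Squnion>\<^bsub>L\<^esub>A)"
      using A by (simp add: rect_le_iff in1_closed) (simp add: coprod_in1_def)
  next
    fix W assume "W \<in> carrier P" and le: "\<And>X. X \<in> in1 ` A \<Longrightarrow> X \<sqsubseteq>\<^bsub>P\<^esub> W"
    then have W: "W \<in> cideals L M" by simp
    have "(a, \<top>\<^bsub>M\<^esub>) \<in> W" if "a \<in> A" for a
      using le[of "in1 a"] that A W rect_le_iff[of a "\<top>\<^bsub>M\<^esub>" W] in1_rect by auto
    then have "(\<Squnion>\<^bsub>L\<^esub>A, \<top>\<^bsub>M\<^esub>) \<in> W"
      using cidealsD(3)[OF W A] by simp
    then show "in1 (\<Squnion>\<^bsub>L\<^esub>A) \<sqsubseteq>\<^bsub>P\<^esub> W"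
      using A W by (simp add: in1_rect rect_le_iff)
  qed (use A in1_closed in auto)
next
  fix x y assume "x \<in> carrier L" "y \<in> carrier L"
  then show "in1 (x \<sqinter>\<^bsub>L\<^esub> y) = in1 x \<sqinter>\<^bsub>P\<^esub> in1 y"
    by (subst P_meet) (auto simp: in1_closed, auto simp: coprod_in1_def le_meet_iff1)
qed (auto simp: in1_closed P_top, auto simp: coprod_in1_def)

lemma in2_hom: "in2 \<in> frame_hom M P"
proof (rule frame_homI)
  interpret P: complete_lattice P by (rule complete_lattice_P)
  fix B assume B: "B \<subseteq> carrier M"
  show "in2 (\<Squnion>\<^bsub>M\<^esub>B) = \<Squnion>\<^bsub>P\<^esub>(in2 ` B)"
  proof (rule P.sup_eqI[symmetric])
    fix X assume "X \<in> in2 ` B"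
    then obtain b where b: "b \<in> B" "X = in2 b" by blast
    then have "X = rect \<top>\<^bsub>L\<^esub> b" "b \<in> carrier M" "b \<sqsubseteq>\<^bsub>M\<^esub> \<Squnion>\<^bsub>M\<^esub>B"
      using B in2_rect M.sup_upper by auto
    then show "X \<sqsubseteq>\<^bsub>P\<^esub> in2 (\<Squnion>\<^bsub>M\<^esub>B)"
      using B by (simp add: rect_le_iff in2_closed) (simp add: coprod_in2_def)
  next
    fix W assume "W \<in> carrier P" and le: "\<And>X. X \<in> in2 ` B \<Longrightarrow> X \<sqsubseteq>\<^bsub>P\<^esub> W"
    then have W: "W \<in> cideals L M" by simp
    have "(\<top>\<^bsub>L\<^esub>, b) \<in> W" if "b \<in> B" for b
      using le[of "in2 b"] that B W rect_le_iff[of "\<top>\<^bsub>L\<^esub>" b W] in2_rect by auto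
    then have "(\<top>\<^bsub>L\<^esub>, \<Squnion>\<^bsub>M\<^esub>B) \<in> W"
      using cidealsD(4)[OF W _ B] by simp
    then show "in2 (\<Squnion>\<^bsub>M\<^esub>B) \<sqsubseteq>\<^bsub>P\<^esub> W"
      using B W by (simp add: in2_rect rect_le_iff)
  qed (use B in2_closed in auto)
next
  fix x y assume "x \<in> carrier M" "y \<in> carrier M"
  then show "in2 (x \<sqinter>\<^bsub>M\<^esub> y) = in2 x \<sqinter>\<^bsub>P\<^esub> in2 y"
    by (subst P_meet) (auto simp: in2_closed, auto simp: coprod_in2_def le_meet_iff2)
qed (auto simp: in2_closed P_top, auto simp: coprod_in2_def)

lemma cideal_eq_sup:
  assumes U: "U \<in> cideals L M"
  shows "U = \<Squnion>\<^bsub>P\<^esub>((\<lambda>(a, b). in1 a \<sqinter>\<^bsub>P\<^esub> in2 b) ` U)"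
proof -
  interpret P: complete_lattice P by (rule complete_lattice_P)
  have c: "a \<in> carrier L \<and> b \<in> carrier M" if "(a, b) \<in> U" for a b
    using that cidealsD(1)[OF U] by blast
  have eq: "(\<lambda>(a, b). in1 a \<sqinter>\<^bsub>P\<^esub> in2 b) ` U = (\<lambda>(a, b). rect a b) ` U"
    by (rule image_cong[OF refl]) (use c in1_meet_in2 in auto)
  show ?thesis
    unfolding eq
  proof (rule P.sup_eqI[symmetric])
    show "(\<lambda>(a, b). rect a b) ` U \<subseteq> carrier P" using c rect_cideal by auto
    show "U \<in> carrier P" using U by simp
    show "X \<sqsubseteq>\<^bsub>P\<^esub> U" if X: "X \<in> (\<lambda>(a, b). rect a b) ` U" for X
    proof -
      obtain a b where "(a, b) \<in> U" "X = rect a b" using X by auto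
      then show ?thesis using c rect_le_iff[OF _ _ U] by simp
    qed
    fix W assume W: "W \<in> carrier P" and le: "\<And>X. X \<in> (\<lambda>(a, b). rect a b) ` U \<Longrightarrow> X \<sqsubseteq>\<^bsub>P\<^esub> W"
    have "(a, b) \<in> W" if ab: "(a, b) \<in> U" for a b
    proof -
      have "rect a b \<in> (\<lambda>(a, b). rect a b) ` U" using ab by (rule rev_image_eqI) simp
      then show ?thesis using le c[OF ab] W rect_le_iff[of a b W] by simp
    qed
    then show "U \<sqsubseteq>\<^bsub>P\<^esub> W" by auto
  qed
qed

lemma coprod_universal:
  assumes "frame N" and f: "f \<in> frame_hom L N" and g: "g \<in> frame_hom M N"
  shows "\<exists>!h. h \<in> frame_hom P N \<and> (\<forall>a \<in> carrier L. h (in1 a) = f a) \<and>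
    (\<forall>b \<in> carrier M. h (in2 b) = g b)"
proof (rule ex_ex1I)
  interpret N: frame N by fact
  interpret P: complete_lattice P by (rule complete_lattice_P)
  note fc = frame_homD(1)[OF f] and gc = frame_homD(1)[OF g]
  define k where "k = (\<lambda>(a, b). f a \<sqinter>\<^bsub>N\<^esub> g b)"
  define h where "h = (\<lambda>U \<in> cideals L M. \<Squnion>\<^bsub>N\<^esub>(k ` U))"
  have kc: "k ` U \<subseteq> carrier N" if "U \<in> cideals L M" for U
    using cidealsD(1)[OF that] fc gc by (auto simp: k_def)
  have hc: "h U \<in> carrier N" if "U \<in> cideals L M" for U
    using that kc by (simp add: h_def)
  have k_le_h: "k p \<sqsubseteq>\<^bsub>N\<^esub> h U" if "U \<in> cideals L M" "p \<in> U" for U p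
    using that kc N.sup_upper by (simp add: h_def)
  have h_le: "h U \<sqsubseteq>\<^bsub>N\<^esub> n"
    if "U \<in> cideals L M" "n \<in> carrier N" "\<And>a b. (a, b) \<in> U \<Longrightarrow> f a \<sqinter>\<^bsub>N\<^esub> g b \<sqsubseteq>\<^bsub>N\<^esub> n" for U n
    using that(1,2) kc[OF that(1)] that(3) by (auto simp: h_def k_def intro!: N.sup_least)
  have h_mono: "h U \<sqsubseteq>\<^bsub>N\<^esub> h V" if "U \<in> cideals L M" "V \<in> cideals L M" "U \<subseteq> V" for U V
  proof (rule h_le[OF that(1) hc[OF that(2)]])
    fix a b assume "(a, b) \<in> U"
    then show "f a \<sqinter>\<^bsub>N\<^esub> g b \<sqsubseteq>\<^bsub>N\<^esub> h V"
      using k_le_h[OF that(2), of "(a, b)"] that(3) by (auto simp: k_def)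
  qed
  have down: "{(a, b) \<in> carrier L \<times> carrier M. f a \<sqinter>\<^bsub>N\<^esub> g b \<sqsubseteq>\<^bsub>N\<^esub> n} \<in> cideals L M" (is "?D \<in> _")
    if n: "n \<in> carrier N" for n
  proof (rule cidealsI)
    fix x y x' y'
    assume *: "(x, y) \<in> ?D" "x' \<in> carrier L" "y' \<in> carrier M" "x' \<sqsubseteq>\<^bsub>L\<^esub> x" "y' \<sqsubseteq>\<^bsub>M\<^esub> y"
    then have c: "x \<in> carrier L" "y \<in> carrier M" by auto
    have fg: "f x' \<sqsubseteq>\<^bsub>N\<^esub> f x" "g y' \<sqsubseteq>\<^bsub>N\<^esub> g y"
      using * c frame_hom_mono[OF L.complete_lattice_axioms N.complete_lattice_axioms f]
        frame_hom_mono[OF M.complete_lattice_axioms N.complete_lattice_axioms g] by auto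
    have "f x' \<sqinter>\<^bsub>N\<^esub> g y' \<sqsubseteq>\<^bsub>N\<^esub> f x \<sqinter>\<^bsub>N\<^esub> g y"
      using * c fc gc fg N.le_trans[OF N.meet_left fg(1)] N.le_trans[OF N.meet_right fg(2)]
      by (intro N.meet_le) auto
    then show "(x', y') \<in> ?D"
      using * c fc gc n N.le_trans[of "f x' \<sqinter>\<^bsub>N\<^esub> g y'" "f x \<sqinter>\<^bsub>N\<^esub> g y" n] by auto
  next
    fix A b assume *: "A \<subseteq> carrier L" "b \<in> carrier M" "\<And>a. a \<in> A \<Longrightarrow> (a, b) \<in> ?D"
    have fA: "f ` A \<subseteq> carrier N" using * fc by auto
    have "f (\<Squnion>\<^bsub>L\<^esub>A) \<sqinter>\<^bsub>N\<^esub> g b = g b \<sqinter>\<^bsub>N\<^esub> \<Squnion>\<^bsub>N\<^esub>(f ` A)"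
      using frame_homD(2)[OF f *(1)] by (simp add: meet_comm)
    also have "\<dots> = \<Squnion>\<^bsub>N\<^esub>((\<lambda>c. g b \<sqinter>\<^bsub>N\<^esub> c) ` f ` A)"
      using N.meet_sup_distrib fA gc *(2) by blast
    also have "\<dots> \<sqsubseteq>\<^bsub>N\<^esub> n"
    proof (rule N.sup_least)
      fix z assume "z \<in> (\<lambda>c. g b \<sqinter>\<^bsub>N\<^esub> c) ` f ` A"
      then obtain a where a: "a \<in> A" "z = g b \<sqinter>\<^bsub>N\<^esub> f a" by blast
      then show "z \<sqsubseteq>\<^bsub>N\<^esub> n" using *(3)[OF a(1)] meet_comm[of N "g b" "f a"] by simp
    qed (use n fA gc * in auto)
    finally show "(\<Squnion>\<^bsub>L\<^esub>A, b) \<in> ?D" using * by auto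
  next
    fix a B assume *: "a \<in> carrier L" "B \<subseteq> carrier M" "\<And>b. b \<in> B \<Longrightarrow> (a, b) \<in> ?D"
    have gB: "g ` B \<subseteq> carrier N" using * gc by auto
    have "f a \<sqinter>\<^bsub>N\<^esub> g (\<Squnion>\<^bsub>M\<^esub>B) = \<Squnion>\<^bsub>N\<^esub>((\<lambda>c. f a \<sqinter>\<^bsub>N\<^esub> c) ` g ` B)"
      using frame_homD(2)[OF g *(2)] N.meet_sup_distrib[OF _ gB] fc *(1) by simp
    also have "\<dots> \<sqsubseteq>\<^bsub>N\<^esub> n"
    proof (rule N.sup_least)
      fix z assume "z \<in> (\<lambda>c. f a \<sqinter>\<^bsub>N\<^esub> c) ` g ` B"
      then obtain b where b: "b \<in> B" "z = f a \<sqinter>\<^bsub>N\<^esub> g b" by blast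
      then show "z \<sqsubseteq>\<^bsub>N\<^esub> n" using *(3)[OF b(1)] by simp
    qed (use n gB fc * in auto)
    finally show "(a, \<Squnion>\<^bsub>M\<^esub>B) \<in> ?D" using * by auto
  qed blast
  have h_rect: "h (rect a b) = f a \<sqinter>\<^bsub>N\<^esub> g b" if a: "a \<in> carrier L" and b: "b \<in> carrier M" for a b
  proof (rule N.le_antisym)
    have n: "f a \<sqinter>\<^bsub>N\<^esub> g b \<in> carrier N" using a b fc gc by simp
    have "rect a b \<subseteq> {(x, y) \<in> carrier L \<times> carrier M. f x \<sqinter>\<^bsub>N\<^esub> g y \<sqsubseteq>\<^bsub>N\<^esub> f a \<sqinter>\<^bsub>N\<^esub> g b}"
      unfolding rect_le_iff[OF a b down[OF n]] using a b n by simp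
    then show "h (rect a b) \<sqsubseteq>\<^bsub>N\<^esub> f a \<sqinter>\<^bsub>N\<^esub> g b"
      by (intro h_le[OF rect_cideal[OF a b] n]) blast
    have "(a, b) \<in> rect a b" using a b by (simp add: rect_def)
    then show "f a \<sqinter>\<^bsub>N\<^esub> g b \<sqsubseteq>\<^bsub>N\<^esub> h (rect a b)"
      using k_le_h[OF rect_cideal[OF a b]] by (force simp: k_def)
  qed (use a b fc gc hc rect_cideal in auto)
  have meet_top: "z \<sqinter>\<^bsub>N\<^esub> \<top>\<^bsub>N\<^esub> = z" "\<top>\<^bsub>N\<^esub> \<sqinter>\<^bsub>N\<^esub> z = z" if "z \<in> carrier N" for z
    using that N.le_iff_meet_eq[of z "\<top>\<^bsub>N\<^esub>"] by (simp_all add: meet_comm)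
  have h1: "h (in1 a) = f a" if "a \<in> carrier L" for a
    using that fc frame_homD(4)[OF g] by (simp add: in1_rect h_rect meet_top)
  have h2: "h (in2 b) = g b" if "b \<in> carrier M" for b
    using that gc frame_homD(4)[OF f] by (simp add: in2_rect h_rect meet_top)
  have "h \<in> frame_hom P N"
  proof (rule frame_homI)
    fix K assume "K \<subseteq> carrier P"
    then have K: "K \<subseteq> cideals L M" by simp
    show "h (\<Squnion>\<^bsub>P\<^esub>K) = \<Squnion>\<^bsub>N\<^esub>(h ` K)"
    proof (rule N.sup_eqI[symmetric])
      show "h ` K \<subseteq> carrier N" using K hc by auto
      show "h (\<Squnion>\<^bsub>P\<^esub>K) \<in> carrier N" using hc P_sup_closed[OF K] .
      show "z \<sqsubseteq>\<^bsub>N\<^esub> h (\<Squnion>\<^bsub>P\<^esub>K)" if "z \<in> h ` K" for z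
        using that K h_mono P_sup_upper[OF K] P_sup_closed[OF K] by blast
      fix n assume n: "n \<in> carrier N" and le: "\<And>z. z \<in> h ` K \<Longrightarrow> z \<sqsubseteq>\<^bsub>N\<^esub> n"
      have "U \<subseteq> {(a, b) \<in> carrier L \<times> carrier M. f a \<sqinter>\<^bsub>N\<^esub> g b \<sqsubseteq>\<^bsub>N\<^esub> n}" if U: "U \<in> K" for U
      proof
        fix p assume "p \<in> U"
        moreover obtain a b where p: "p = (a, b)" by (cases p)
        ultimately have ab: "(a, b) \<in> U" by simp
        have Uc: "U \<in> cideals L M" using U K by blast
        then have c: "a \<in> carrier L" "b \<in> carrier M" using ab cidealsD(1) by blast+
        have "f a \<sqinter>\<^bsub>N\<^esub> g b \<sqsubseteq>\<^bsub>N\<^esub> h U" using k_le_h[OF Uc ab] by (simp add: k_def)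
        moreover have "h U \<sqsubseteq>\<^bsub>N\<^esub> n" using le U by blast
        ultimately show "p \<in> {(a, b) \<in> carrier L \<times> carrier M. f a \<sqinter>\<^bsub>N\<^esub> g b \<sqsubseteq>\<^bsub>N\<^esub> n}"
          unfolding p using N.le_trans[of "f a \<sqinter>\<^bsub>N\<^esub> g b" "h U" n] c fc gc hc Uc n by auto
      qed
      then have "\<Squnion>\<^bsub>P\<^esub>K \<subseteq> {(a, b) \<in> carrier L \<times> carrier M. f a \<sqinter>\<^bsub>N\<^esub> g b \<sqsubseteq>\<^bsub>N\<^esub> n}"
        by (intro P_sup_least[OF K down[OF n]])
      then show "h (\<Squnion>\<^bsub>P\<^esub>K) \<sqsubseteq>\<^bsub>N\<^esub> n"
        by (intro h_le[OF P_sup_closed[OF K] n]) blast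
    qed
  next
    fix U V assume "U \<in> carrier P" "V \<in> carrier P"
    then have U: "U \<in> cideals L M" and V: "V \<in> cideals L M" by auto
    note UV = cideals_Int[OF U V]
    have "h (U \<inter> V) = h U \<sqinter>\<^bsub>N\<^esub> h V"
    proof (rule N.meet_eqI[symmetric])
      fix n assume n: "n \<in> carrier N" "n \<sqsubseteq>\<^bsub>N\<^esub> h U" "n \<sqsubseteq>\<^bsub>N\<^esub> h V"
      have le: "h U \<sqinter>\<^bsub>N\<^esub> k p \<sqsubseteq>\<^bsub>N\<^esub> h (U \<inter> V)" if p: "p \<in> V" for p
      proof -
        obtain c d where cd: "p = (c, d)" by (cases p)
        have cdc: "c \<in> carrier L" "d \<in> carrier M" using cidealsD(1)[OF V] p cd by auto
        have kp: "k p \<in> carrier N" using kc[OF V] p by blast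
        have "h U \<sqinter>\<^bsub>N\<^esub> k p = \<Squnion>\<^bsub>N\<^esub>((\<lambda>z. k p \<sqinter>\<^bsub>N\<^esub> z) ` k ` U)"
          using U N.meet_sup_distrib[OF kp kc[OF U]] by (simp add: h_def meet_comm)
        also have "\<dots> \<sqsubseteq>\<^bsub>N\<^esub> h (U \<inter> V)"
        proof (rule N.sup_least)
          fix z assume "z \<in> (\<lambda>z. k p \<sqinter>\<^bsub>N\<^esub> z) ` k ` U"
          then obtain a b where ab: "(a, b) \<in> U" "z = k p \<sqinter>\<^bsub>N\<^esub> k (a, b)" by auto
          have abc: "a \<in> carrier L" "b \<in> carrier M" using cidealsD(1)[OF U] ab by auto
          have "(c \<sqinter>\<^bsub>L\<^esub> a, d \<sqinter>\<^bsub>M\<^esub> b) \<in> U"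
            using cidealsD(2)[OF U ab(1)] abc cdc L.meet_right M.meet_right by simp
          moreover have "(c \<sqinter>\<^bsub>L\<^esub> a, d \<sqinter>\<^bsub>M\<^esub> b) \<in> V"
            using cidealsD(2)[OF V p[unfolded cd]] abc cdc L.meet_left M.meet_left by simp
          ultimately have "k (c \<sqinter>\<^bsub>L\<^esub> a, d \<sqinter>\<^bsub>M\<^esub> b) \<sqsubseteq>\<^bsub>N\<^esub> h (U \<inter> V)"
            using k_le_h[OF UV] by blast
          moreover have "k (c \<sqinter>\<^bsub>L\<^esub> a, d \<sqinter>\<^bsub>M\<^esub> b) = z"
          proof -
            have "(f c \<sqinter>\<^bsub>N\<^esub> f a) \<sqinter>\<^bsub>N\<^esub> (g d \<sqinter>\<^bsub>N\<^esub> g b) = (f c \<sqinter>\<^bsub>N\<^esub> g d) \<sqinter>\<^bsub>N\<^esub> (f a \<sqinter>\<^bsub>N\<^esub> g b)"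
              using fc gc abc cdc N.meet_assoc N.meet_closed meet_comm by metis
            then show ?thesis
              using abc cdc ab cd frame_homD(3)[OF f] frame_homD(3)[OF g] by (simp add: k_def)
          qed
          ultimately show "z \<sqsubseteq>\<^bsub>N\<^esub> h (U \<inter> V)" by simp
        qed (use kc[OF U] kp hc[OF UV] in auto)
        finally show ?thesis .
      qed
      have "h U \<sqinter>\<^bsub>N\<^esub> h V = \<Squnion>\<^bsub>N\<^esub>((\<lambda>z. h U \<sqinter>\<^bsub>N\<^esub> z) ` k ` V)"
        using V N.meet_sup_distrib[OF hc[OF U] kc[OF V]] by (simp add: h_def)
      also have "\<dots> \<sqsubseteq>\<^bsub>N\<^esub> h (U \<inter> V)"
        by (rule N.sup_least) (use kc[OF V] hc[OF U] hc[OF UV] le in auto)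
      finally have "h U \<sqinter>\<^bsub>N\<^esub> h V \<sqsubseteq>\<^bsub>N\<^esub> h (U \<inter> V)" .
      moreover have "n \<sqsubseteq>\<^bsub>N\<^esub> h U \<sqinter>\<^bsub>N\<^esub> h V"
        using n hc[OF U] hc[OF V] by (intro N.meet_le)
      ultimately show "n \<sqsubseteq>\<^bsub>N\<^esub> h (U \<inter> V)"
        using n(1) hc[OF U] hc[OF V] hc[OF UV] by (meson N.le_trans N.meet_closed)
    qed (use U V UV hc h_mono in auto)
    then show "h (U \<sqinter>\<^bsub>P\<^esub> V) = h U \<sqinter>\<^bsub>N\<^esub> h V"
      by (simp add: P_meet U V)
  next
    have "\<top>\<^bsub>P\<^esub> = in1 \<top>\<^bsub>L\<^esub>" using frame_homD(4)[OF in1_hom] by simp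
    then show "h \<top>\<^bsub>P\<^esub> = \<top>\<^bsub>N\<^esub>" using h1 frame_homD(4)[OF f] by simp
  qed (auto simp: hc, auto simp: h_def)
  then show "\<exists>h. h \<in> frame_hom P N \<and> (\<forall>a \<in> carrier L. h (in1 a) = f a) \<and>
      (\<forall>b \<in> carrier M. h (in2 b) = g b)"
    using h1 h2 by blast
next
  fix h h'
  assume h: "h \<in> frame_hom P N \<and> (\<forall>a \<in> carrier L. h (in1 a) = f a) \<and>
      (\<forall>b \<in> carrier M. h (in2 b) = g b)"
    and h': "h' \<in> frame_hom P N \<and> (\<forall>a \<in> carrier L. h' (in1 a) = f a) \<and>
      (\<forall>b \<in> carrier M. h' (in2 b) = g b)"
  have val: "j U = \<Squnion>\<^bsub>N\<^esub>((\<lambda>(a, b). f a \<sqinter>\<^bsub>N\<^esub> g b) ` U)"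
    if j: "j \<in> frame_hom P N \<and> (\<forall>a \<in> carrier L. j (in1 a) = f a) \<and>
      (\<forall>b \<in> carrier M. j (in2 b) = g b)" and U: "U \<in> cideals L M" for j U
  proof -
    have c: "a \<in> carrier L \<and> b \<in> carrier M" if "(a, b) \<in> U" for a b
      using that cidealsD(1)[OF U] by blast
    have jh: "j \<in> frame_hom P N" using j by blast
    have sub: "(\<lambda>(a, b). in1 a \<sqinter>\<^bsub>P\<^esub> in2 b) ` U \<subseteq> carrier P"
      using c by (auto simp: in1_meet_in2 rect_cideal)
    have "j U = j (\<Squnion>\<^bsub>P\<^esub>((\<lambda>(a, b). in1 a \<sqinter>\<^bsub>P\<^esub> in2 b) ` U))"
      using cideal_eq_sup[OF U] by simp
    also have "\<dots> = \<Squnion>\<^bsub>N\<^esub>(j ` (\<lambda>(a, b). in1 a \<sqinter>\<^bsub>P\<^esub> in2 b) ` U)"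
      by (rule frame_homD(2)[OF jh sub])
    also have "j ` (\<lambda>(a, b). in1 a \<sqinter>\<^bsub>P\<^esub> in2 b) ` U = (\<lambda>(a, b). f a \<sqinter>\<^bsub>N\<^esub> g b) ` U"
      unfolding image_image
      by (rule image_cong[OF refl])
        (use c j frame_homD(3)[OF jh] in1_closed in2_closed in auto)
    finally show ?thesis .
  qed
  show "h = h'"
  proof (rule extensionalityI)
    show "h \<in> extensional (carrier P)" "h' \<in> extensional (carrier P)"
      using h h' frame_homD(5) by blast+
    show "h U = h' U" if "U \<in> carrier P" for U
      using val[OF h] val[OF h'] that by simp
  qed
qed

end

definition copair ::
    "('a, 'c) gorder_scheme \<Rightarrow> ('b, 'd) gorder_scheme \<Rightarrow> ('l, 'e) gorder_scheme \<Rightarrow>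
     ('a \<Rightarrow> 'l) \<Rightarrow> ('b \<Rightarrow> 'l) \<Rightarrow> ('a \<times> 'b) set \<Rightarrow> 'l" where
  "copair L M N f g = (THE h. h \<in> frame_hom (coprod L M) N \<and>
     (\<forall>a \<in> carrier L. h (coprod_in1 L M a) = f a) \<and>
     (\<forall>b \<in> carrier M. h (coprod_in2 L M b) = g b))"

lemma copair_props:
  assumes "frame L" "frame M" "frame N" "f \<in> frame_hom L N" "g \<in> frame_hom M N"
  shows "copair L M N f g \<in> frame_hom (coprod L M) N"
    and "\<And>a. a \<in> carrier L \<Longrightarrow> copair L M N f g (coprod_in1 L M a) = f a"
    and "\<And>b. b \<in> carrier M \<Longrightarrow> copair L M N f g (coprod_in2 L M b) = g b"
  using theI'[OF frame_pair.coprod_universal[OF _ assms(3-5)]] assms(1,2)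
  unfolding copair_def[symmetric] by (auto simp: frame_pair_def)


section \<open>Biframes\<close>

record ('a, 'b, 'l) biframe =
  pos :: "'a gorder"
  neg :: "'b gorder"
  main :: "'l gorder"
  epos :: "'a \<Rightarrow> 'l"
  eneg :: "'b \<Rightarrow> 'l"

definition basic_elems :: "('a, 'b, 'l) biframe \<Rightarrow> 'l set" where
  "basic_elems B = {epos B x \<sqinter>\<^bsub>main B\<^esub> eneg B y | x y. x \<in> carrier (pos B) \<and> y \<in> carrier (neg B)}"

definition is_biframe :: "('a, 'b, 'l) biframe \<Rightarrow> bool" where
  "is_biframe B \<longleftrightarrow> frame (pos B) \<and> frame (neg B) \<and> frame (main B) \<and>
     epos B \<in> frame_hom (pos B) (main B) \<and> inj_on (epos B) (carrier (pos B)) \<and>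
     eneg B \<in> frame_hom (neg B) (main B) \<and> inj_on (eneg B) (carrier (neg B)) \<and>
     (\<forall>x \<in> carrier (main B). \<exists>S \<subseteq> basic_elems B. x = \<Squnion>\<^bsub>main B\<^esub>S)"

definition biframe_hom ::
    "('a, 'b, 'l) biframe \<Rightarrow> ('c, 'd, 'm) biframe \<Rightarrow> (('a \<Rightarrow> 'c) \<times> ('b \<Rightarrow> 'd)) set" where
  "biframe_hom B B' = {(f, g). f \<in> frame_hom (pos B) (pos B') \<and> g \<in> frame_hom (neg B) (neg B') \<and>
     (\<exists>h \<in> frame_hom (main B) (main B').
        (\<forall>x \<in> carrier (pos B). h (epos B x) = epos B' (f x)) \<and>
        (\<forall>y \<in> carrier (neg B). h (eneg B y) = eneg B' (g y)))}"

definition fin_elems :: "('a, 'b, 'l) biframe \<Rightarrow> 'l set" where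
  "fin_elems B = {\<Squnion>\<^bsub>main B\<^esub>F | F. finite F \<and> F \<subseteq> basic_elems B}"

definition finitary_congruence :: "('a, 'b, 'l) biframe \<Rightarrow> ('l \<times> 'l) set \<Rightarrow> bool" where
  "finitary_congruence B C \<longleftrightarrow>
     (\<exists>R \<subseteq> fin_elems B \<times> fin_elems B. C = gen_congruence (main B) R)"

definition coprod_biframe :: "('a, 'b, 'l) biframe \<Rightarrow> ('a, 'b, ('a \<times> 'b) set) biframe" where
  "coprod_biframe B = \<lparr>pos = pos B, neg = neg B, main = coprod (pos B) (neg B),
     epos = coprod_in1 (pos B) (neg B), eneg = coprod_in2 (pos B) (neg B)\<rparr>"

definition coprod_kernel ::
    "('a, 'b, 'l) biframe \<Rightarrow> (('a \<times> 'b) set \<times> ('a \<times> 'b) set) set" where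
  "coprod_kernel B = hom_kernel (coprod (pos B) (neg B))
     (copair (pos B) (neg B) (main B) (epos B) (eneg B))"

definition is_finitary :: "('a, 'b, 'l) biframe \<Rightarrow> bool" where
  "is_finitary B \<longleftrightarrow> finitary_congruence (coprod_biframe B) (coprod_kernel B)"


section \<open>Categories and adjunctions\<close>

text \<open>Homs are indexed families and need not be disjoint. In \<open>Cmp C X Y Z g f\<close> one has
  \<open>f : X \<rightarrow> Y\<close> and \<open>g : Y \<rightarrow> Z\<close>.\<close>

record ('o, 'm) cat =
  Ob :: "'o set"
  Hom :: "'o \<Rightarrow> 'o \<Rightarrow> 'm set"
  Idt :: "'o \<Rightarrow> 'm"
  Cmp :: "'o \<Rightarrow> 'o \<Rightarrow> 'o \<Rightarrow> 'm \<Rightarrow> 'm \<Rightarrow> 'm"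

definition category :: "('o, 'm) cat \<Rightarrow> bool" where
  "category C \<longleftrightarrow>
     (\<forall>X \<in> Ob C. Idt C X \<in> Hom C X X) \<and>
     (\<forall>X \<in> Ob C. \<forall>Y \<in> Ob C. \<forall>Z \<in> Ob C. \<forall>f \<in> Hom C X Y. \<forall>g \<in> Hom C Y Z.
        Cmp C X Y Z g f \<in> Hom C X Z) \<and>
     (\<forall>X \<in> Ob C. \<forall>Y \<in> Ob C. \<forall>f \<in> Hom C X Y.
        Cmp C X X Y f (Idt C X) = f \<and> Cmp C X Y Y (Idt C Y) f = f) \<and>
     (\<forall>W \<in> Ob C. \<forall>X \<in> Ob C. \<forall>Y \<in> Ob C. \<forall>Z \<in> Ob C.
        \<forall>f \<in> Hom C W X. \<forall>g \<in> Hom C X Y. \<forall>h \<in> Hom C Y Z.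
        Cmp C W X Z (Cmp C X Y Z h g) f = Cmp C W Y Z h (Cmp C W X Y g f))"

definition full_subcat :: "('o, 'm) cat \<Rightarrow> ('o \<Rightarrow> bool) \<Rightarrow> ('o, 'm) cat" where
  "full_subcat C P = C\<lparr>Ob := {X \<in> Ob C. P X}\<rparr>"

record ('o, 'm, 'p, 'n) fctr =
  FOb :: "'o \<Rightarrow> 'p"
  FHom :: "'o \<Rightarrow> 'o \<Rightarrow> 'm \<Rightarrow> 'n"

definition is_functor ::
    "('o, 'm) cat \<Rightarrow> ('p, 'n) cat \<Rightarrow> ('o, 'm, 'p, 'n) fctr \<Rightarrow> bool" where
  "is_functor C D F \<longleftrightarrow> category C \<and> category D \<and>
     (\<forall>X \<in> Ob C. FOb F X \<in> Ob D) \<and>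
     (\<forall>X \<in> Ob C. \<forall>Y \<in> Ob C. \<forall>f \<in> Hom C X Y. FHom F X Y f \<in> Hom D (FOb F X) (FOb F Y)) \<and>
     (\<forall>X \<in> Ob C. FHom F X X (Idt C X) = Idt D (FOb F X)) \<and>
     (\<forall>X \<in> Ob C. \<forall>Y \<in> Ob C. \<forall>Z \<in> Ob C. \<forall>f \<in> Hom C X Y. \<forall>g \<in> Hom C Y Z.
        FHom F X Z (Cmp C X Y Z g f) =
          Cmp D (FOb F X) (FOb F Y) (FOb F Z) (FHom F Y Z g) (FHom F X Y f))"

definition id_functor :: "('o, 'm, 'o, 'm) fctr" where
  "id_functor = \<lparr>FOb = (\<lambda>X. X), FHom = (\<lambda>X Y f. f)\<rparr>"

definition comp_functor ::
    "('p, 'n, 'q, 'k) fctr \<Rightarrow> ('o, 'm, 'p, 'n) fctr \<Rightarrow> ('o, 'm, 'q, 'k) fctr" where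
  "comp_functor G F = \<lparr>FOb = (\<lambda>X. FOb G (FOb F X)),
     FHom = (\<lambda>X Y f. FHom G (FOb F X) (FOb F Y) (FHom F X Y f))\<rparr>"

definition nat_transf ::
    "('o, 'm) cat \<Rightarrow> ('p, 'n) cat \<Rightarrow> ('o, 'm, 'p, 'n) fctr \<Rightarrow> ('o, 'm, 'p, 'n) fctr \<Rightarrow>
     ('o \<Rightarrow> 'n) \<Rightarrow> bool" where
  "nat_transf C D F G t \<longleftrightarrow> is_functor C D F \<and> is_functor C D G \<and>
     (\<forall>X \<in> Ob C. t X \<in> Hom D (FOb F X) (FOb G X)) \<and>
     (\<forall>X \<in> Ob C. \<forall>Y \<in> Ob C. \<forall>f \<in> Hom C X Y.
        Cmp D (FOb F X) (FOb F Y) (FOb G Y) (t Y) (FHom F X Y f) =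
        Cmp D (FOb F X) (FOb G X) (FOb G Y) (FHom G X Y f) (t X))"

text \<open>\<open>adjunction C D F G \<eta> \<epsilon>\<close>: the functor \<open>F : C \<rightarrow> D\<close> is left adjoint to
  \<open>G : D \<rightarrow> C\<close>, with unit \<open>\<eta>\<close> and counit \<open>\<epsilon>\<close>.\<close>

definition adjunction ::
    "('o, 'm) cat \<Rightarrow> ('p, 'n) cat \<Rightarrow> ('o, 'm, 'p, 'n) fctr \<Rightarrow> ('p, 'n, 'o, 'm) fctr \<Rightarrow>
     ('o \<Rightarrow> 'm) \<Rightarrow> ('p \<Rightarrow> 'n) \<Rightarrow> bool" where
  "adjunction C D F G \<eta> \<epsilon> \<longleftrightarrow>
     is_functor C D F \<and> is_functor D C G \<and>
     nat_transf C C id_functor (comp_functor G F) \<eta> \<and>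
     nat_transf D D (comp_functor F G) id_functor \<epsilon> \<and>
     (\<forall>X \<in> Ob C.
        Cmp D (FOb F X) (FOb F (FOb G (FOb F X))) (FOb F X)
          (\<epsilon> (FOb F X)) (FHom F X (FOb G (FOb F X)) (\<eta> X)) = Idt D (FOb F X)) \<and>
     (\<forall>Y \<in> Ob D.
        Cmp C (FOb G Y) (FOb G (FOb F (FOb G Y))) (FOb G Y)
          (FHom G (FOb F (FOb G Y)) Y (\<epsilon> Y)) (\<eta> (FOb G Y)) = Idt C (FOb G Y))"


section \<open>The categories of biframes and of finitary biframes\<close>

text \<open>The component types \<open>'a\<close>, \<open>'b\<close>, \<open>'l\<close> serve as universes: the objects of \<open>BiFrm\<close> are
  all biframes whose components have their carriers in these types.\<close>

type_synonym ('a, 'b) biframe_map = "('a \<Rightarrow> 'a) \<times> ('b \<Rightarrow> 'b)"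

definition id_map :: "('a, 'b, 'l) biframe \<Rightarrow> ('a, 'b) biframe_map" where
  "id_map B = (\<lambda>x \<in> carrier (pos B). x, \<lambda>y \<in> carrier (neg B). y)"

definition BiFrm :: "(('a, 'b, 'l) biframe, ('a, 'b) biframe_map) cat" where
  "BiFrm = \<lparr>Ob = {B. is_biframe B}, Hom = biframe_hom, Idt = id_map,
     Cmp = (\<lambda>X Y Z g f. (compose (carrier (pos X)) (fst g) (fst f),
                         compose (carrier (neg X)) (snd g) (snd f)))\<rparr>"

definition BiFrm_fin :: "(('a, 'b, 'l) biframe, ('a, 'b) biframe_map) cat" where
  "BiFrm_fin = full_subcat BiFrm is_finitary"

definition incl_functor ::
    "(('a, 'b, 'l) biframe, ('a, 'b) biframe_map, ('a, 'b, 'l) biframe, ('a, 'b) biframe_map) fctr"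
  where "incl_functor = \<lparr>FOb = (\<lambda>B. B), FHom = (\<lambda>X Y f. f)\<rparr>"

definition fin_cong :: "('a, 'b, 'l) biframe \<Rightarrow> (('a \<times> 'b) set \<times> ('a \<times> 'b) set) set" where
  "fin_cong B = gen_congruence (coprod (pos B) (neg B))
     (coprod_kernel B \<inter> fin_elems (coprod_biframe B) \<times> fin_elems (coprod_biframe B))"

definition copy_order :: "('a \<Rightarrow> 'b) \<Rightarrow> 'a gorder \<Rightarrow> 'b gorder" where
  "copy_order j Q = \<lparr>carrier = j ` carrier Q, eq = (=),
     le = (\<lambda>x y. \<exists>u \<in> carrier Q. \<exists>v \<in> carrier Q. x = j u \<and> y = j v \<and> u \<sqsubseteq>\<^bsub>Q\<^esub> v)\<rparr>"

text \<open>The quotient of the coproduct by \<open>fin_cong B\<close> has its carrier in \<open>('a \<times> 'b) set set\<close>. So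
  that it is again an object over the universe \<open>'l\<close> of main components, it is copied there
  along a map \<open>j\<close>, which is meant to be injective (for \<open>'l = ('a \<times> 'b) set set\<close> one may take
  the identity).\<close>

definition fin_biframe ::
    "(('a \<times> 'b) set set \<Rightarrow> 'l) \<Rightarrow> ('a, 'b, 'l) biframe \<Rightarrow> ('a, 'b, 'l) biframe" where
  "fin_biframe j B =
    (let P = coprod (pos B) (neg B); C = fin_cong B in
     \<lparr>pos = pos B, neg = neg B, main = copy_order j (quot_frame P C),
      epos = (\<lambda>x \<in> carrier (pos B). j (quot_map P C (coprod_in1 (pos B) (neg B) x))),
      eneg = (\<lambda>y \<in> carrier (neg B). j (quot_map P C (coprod_in2 (pos B) (neg B) y)))\<rparr>)"

definition fin_functor ::
    "(('a \<times> 'b) set set \<Rightarrow> 'l) \<Rightarrow>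
     (('a, 'b, 'l) biframe, ('a, 'b) biframe_map, ('a, 'b, 'l) biframe, ('a, 'b) biframe_map) fctr"
  where "fin_functor j = \<lparr>FOb = fin_biframe j, FHom = (\<lambda>X Y f. f)\<rparr>"

end

theory Submission
  imports Defs
begin

text \<open>All functors and transformations act identically on the pairs of frame maps, so the only
  issue is whether identity pairs and given pairs remain biframe maps, that is, whether they
  extend to the main components. The main component of \<open>fin(L)\<close> is a quotient of
  \<open>L\<^sup>+ \<oplus> L\<^sup>-\<close> with kernel \<open>fin(C\<^sub>L) \<subseteq> C\<^sub>L\<close>: the inclusion of kernels gives the counit and
  the injectivity of the embeddings of \<open>fin(L)\<close>. If \<open>L\<close> is finitary, the inequalities \<open>a \<le> b\<close>
  generating \<open>C\<^sub>L\<close> can be replaced by \<open>a \<le> a \<sqinter> b\<close>, whose two sides are identified by \<open>C\<^sub>L\<close> and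
  still finite, as finite elements are closed under binary meets; so the kernels are equal and
  the unit exists. Finally, \<open>f\<^sup>+ \<oplus> f\<^sup>-\<close> preserves finite elements and maps \<open>C\<^sub>L\<close> into \<open>C\<^sub>M\<close>,
  hence \<open>fin\<close> is defined on morphisms.\<close>

section \<open>Frame homomorphisms\<close>

lemma frame_hom_id: "complete_lattice L \<Longrightarrow> (\<lambda>x \<in> carrier L. x) \<in> frame_hom L L"
proof -
  assume "complete_lattice L"
  then interpret L: complete_lattice L .
  show ?thesis
  proof (rule frame_homI)
    fix A assume "A \<subseteq> carrier L"
    moreover from this have "(\<lambda>x \<in> carrier L. x) ` A = A" by force
    ultimately show "(\<lambda>x \<in> carrier L. x) (\<Squnion>\<^bsub>L\<^esub>A) = \<Squnion>\<^bsub>L\<^esub>((\<lambda>x \<in> carrier L. x) ` A)" by simp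
  qed auto
qed

lemma frame_hom_compose:
  assumes "complete_lattice L" and f: "f \<in> frame_hom L M" and g: "g \<in> frame_hom M N"
  shows "compose (carrier L) g f \<in> frame_hom L N"
proof -
  interpret L: complete_lattice L by fact
  show ?thesis
  proof (rule frame_homI)
    fix A assume A: "A \<subseteq> carrier L"
    then have fA: "f ` A \<subseteq> carrier M" using frame_homD(1)[OF f] by blast
    have "compose (carrier L) g f ` A = g ` f ` A"
      unfolding image_image by (rule image_cong[OF refl]) (use A in \<open>auto simp: compose_def\<close>)
    then show "compose (carrier L) g f (\<Squnion>\<^bsub>L\<^esub>A) = \<Squnion>\<^bsub>N\<^esub>(compose (carrier L) g f ` A)"
      using A fA by (simp add: compose_def frame_homD(2)[OF f] frame_homD(2)[OF g])
  qed (auto simp: compose_def frame_homD(1,3,4)[OF f] frame_homD(1,3,4)[OF g])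
qed

text \<open>Stated for an arbitrary surjection \<open>h\<close> rather than a quotient map, since it
  is applied both to \<open>fin_proj\<close> and to the canonical map onto the main component. The
  kernel inclusion makes the value independent of the chosen preimage, and surjectivity lets joins
  and meets in \<open>N\<close> be computed upstairs in \<open>L\<close>.\<close>

lemma frame_hom_factor:
  assumes "complete_lattice L" and h: "h \<in> frame_hom L N" and surj: "h ` carrier L = carrier N"
    and f: "f \<in> frame_hom L M" and ker: "hom_kernel L h \<subseteq> hom_kernel L f"
  shows "\<exists>g \<in> frame_hom N M. \<forall>x \<in> carrier L. g (h x) = f x"
proof -
  interpret L: complete_lattice L by fact
  define g where "g = (\<lambda>y \<in> carrier N. f (inv_into (carrier L) h y))"
  have gh: "g (h x) = f x" if x: "x \<in> carrier L" for x
  proof -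
    have hx: "h x \<in> h ` carrier L" using x by blast
    have "(inv_into (carrier L) h (h x), x) \<in> hom_kernel L h"
      using x inv_into_into[OF hx] f_inv_into_f[OF hx] by (simp add: hom_kernel_def)
    then show ?thesis
      using ker x frame_homD(1)[OF h] by (auto simp: g_def hom_kernel_def)
  qed
  have rep: "\<exists>x \<in> carrier L. y = h x" if "y \<in> carrier N" for y
    using that surj by blast
  have "g \<in> frame_hom N M"
  proof (rule frame_homI)
    fix y assume "y \<in> carrier N"
    then show "g y \<in> carrier M" using rep gh frame_homD(1)[OF f] by metis
  next
    fix S assume S: "S \<subseteq> carrier N"
    \<comment> \<open>The full preimage of \<open>S\<close>; its join in \<open>L\<close> is a
      preimage of the join of \<open>S\<close>.\<close>
    define A where "A = {a \<in> carrier L. h a \<in> S}"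
    have A: "A \<subseteq> carrier L" "S = h ` A" using S rep by (auto simp: A_def)
    have "g (\<Squnion>\<^bsub>N\<^esub>S) = f (\<Squnion>\<^bsub>L\<^esub>A)"
      using A gh by (simp flip: frame_homD(2)[OF h])
    also have "\<dots> = \<Squnion>\<^bsub>M\<^esub>(f ` A)" by (rule frame_homD(2)[OF f A(1)])
    also have "f ` A = g ` S"
      unfolding A(2) image_image by (rule image_cong[OF refl]) (use A gh in auto)
    finally show "g (\<Squnion>\<^bsub>N\<^esub>S) = \<Squnion>\<^bsub>M\<^esub>(g ` S)" .
  next
    fix x y assume "x \<in> carrier N" "y \<in> carrier N"
    then obtain a b where "a \<in> carrier L" "b \<in> carrier L" "x = h a" "y = h b"
      using rep by metis
    then show "g (x \<sqinter>\<^bsub>N\<^esub> y) = g x \<sqinter>\<^bsub>M\<^esub> g y"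
      using gh frame_homD(3)[OF f] by (simp flip: frame_homD(3)[OF h])
  next
    show "g \<top>\<^bsub>N\<^esub> = \<top>\<^bsub>M\<^esub>"
      using gh frame_homD(4)[OF f] by (simp flip: frame_homD(4)[OF h])
  qed (simp add: g_def)
  then show ?thesis using gh by blast
qed

lemma gen_congruence_least:
  assumes "frame_congruence L C" "\<And>a b. (a, b) \<in> R \<Longrightarrow> (a \<sqinter>\<^bsub>L\<^esub> b, a) \<in> C"
  shows "gen_congruence L R \<subseteq> C"
  using assms unfolding gen_congruence_def by blast

text \<open>The frame law is used twice, once for each factor. For finite \<open>F\<close> and
  \<open>G\<close> the right-hand side is again a finite join.\<close>

lemma (in frame) sup_meet_sup:
  assumes F: "F \<subseteq> carrier L" and G: "G \<subseteq> carrier L"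
  shows "\<Squnion>F \<sqinter> \<Squnion>G = \<Squnion>((\<lambda>(x, y). x \<sqinter> y) ` (F \<times> G))"
proof (rule sup_eqI[symmetric])
  have c: "x \<in> carrier L" "y \<in> carrier L" if "x \<in> F" "y \<in> G" for x y
    using that F G by auto
  show "(\<lambda>(x, y). x \<sqinter> y) ` (F \<times> G) \<subseteq> carrier L" using c by auto
  show "\<Squnion>F \<sqinter> \<Squnion>G \<in> carrier L" using F G by simp
  fix z assume "z \<in> (\<lambda>(x, y). x \<sqinter> y) ` (F \<times> G)"
  then obtain x y where xy: "x \<in> F" "y \<in> G" "z = x \<sqinter> y" by auto
  have "x \<sqinter> y \<sqsubseteq> \<Squnion>F" "x \<sqinter> y \<sqsubseteq> \<Squnion>G"
    using c[OF xy(1,2)] xy F G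
    by (meson le_trans meet_left meet_right sup_upper meet_closed sup_closed)+
  then show "z \<sqsubseteq> \<Squnion>F \<sqinter> \<Squnion>G"
    using c[OF xy(1,2)] xy F G by (auto intro: meet_le)
next
  fix u assume u: "u \<in> carrier L" and le: "\<And>z. z \<in> (\<lambda>(x, y). x \<sqinter> y) ` (F \<times> G) \<Longrightarrow> z \<sqsubseteq> u"
  \<comment> \<open>Distribute over \<open>F\<close> with \<open>y\<close> fixed; the distribution
    over \<open>G\<close> follows below.\<close>
  have "\<Squnion>F \<sqinter> y \<sqsubseteq> u" if y: "y \<in> G" for y
  proof -
    have "y \<sqinter> \<Squnion>F = \<Squnion>((\<lambda>x. y \<sqinter> x) ` F)"
      using y F G by (intro meet_sup_distrib) auto
    also have "\<dots> \<sqsubseteq> u"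
    proof (rule sup_least)
      fix z assume "z \<in> (\<lambda>x. y \<sqinter> x) ` F"
      then obtain x where x: "x \<in> F" "z = y \<sqinter> x" by blast
      then have "z = x \<sqinter> y" by (simp add: meet_comm)
      then show "z \<sqsubseteq> u" using x y by (intro le) auto
    qed (use u F subsetD[OF G y] in auto)
    finally show ?thesis by (simp add: meet_comm)
  qed
  moreover have "\<Squnion>F \<sqinter> \<Squnion>G = \<Squnion>((\<lambda>y. \<Squnion>F \<sqinter> y) ` G)"
    using F G by (intro meet_sup_distrib) auto
  ultimately show "\<Squnion>F \<sqinter> \<Squnion>G \<sqsubseteq> u"
    using F G u by (auto intro!: sup_least)
qed

text \<open>This is the uniqueness half of the universal property: \<open>h\<close> and
  \<open>k\<close> both mediate the pair of restrictions of \<open>h\<close> along the two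
  injections.\<close>

lemma coprod_hom_eqI:
  assumes "frame L" "frame M" "frame N" and h: "h \<in> frame_hom (coprod L M) N"
    and k: "k \<in> frame_hom (coprod L M) N"
    and eq1: "\<And>a. a \<in> carrier L \<Longrightarrow> h (coprod_in1 L M a) = k (coprod_in1 L M a)"
    and eq2: "\<And>b. b \<in> carrier M \<Longrightarrow> h (coprod_in2 L M b) = k (coprod_in2 L M b)"
  shows "h = k"
proof -
  interpret frame_pair L M using assms(1,2) by (simp add: frame_pair_def)
  have "compose (carrier L) h in1 \<in> frame_hom L N" "compose (carrier M) h in2 \<in> frame_hom M N"
    using frame_hom_compose[OF _ in1_hom h] frame_hom_compose[OF _ in2_hom h] assms(1,2)
      frame_complete by auto
  from coprod_universal[OF assms(3) this] h k eq1 eq2 show ?thesis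
    by (auto simp: compose_def)
qed

section \<open>Transport of the order along an injection\<close>

text \<open>On the carrier, \<open>j\<close> is an order isomorphism onto its image, so it carries
  all joins, meets and the top across. The map is restricted to the carrier because frame maps are
  extensional.\<close>

lemma
  assumes "frame Q" and inj: "inj_on j (carrier Q)"
  shows frame_copy_order: "frame (copy_order j Q)"
    and frame_hom_copy_order: "(\<lambda>x \<in> carrier Q. j x) \<in> frame_hom Q (copy_order j Q)"
proof -
  interpret Q: frame Q by fact
  let ?K = "copy_order j Q"
  have car: "carrier ?K = j ` carrier Q" by (simp add: copy_order_def)
  have le: "j u \<sqsubseteq>\<^bsub>?K\<^esub> j v \<longleftrightarrow> u \<sqsubseteq>\<^bsub>Q\<^esub> v" if "u \<in> carrier Q" "v \<in> carrier Q" for u v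
    using that inj by (auto simp: copy_order_def inj_on_def)
  interpret K: partial_order ?K
  proof
    show "(.=\<^bsub>?K\<^esub>) = (=)" by (simp add: copy_order_def)
  next
    fix x y assume "x \<sqsubseteq>\<^bsub>?K\<^esub> y" "y \<sqsubseteq>\<^bsub>?K\<^esub> x" "x \<in> carrier ?K" "y \<in> carrier ?K"
    then show "x .=\<^bsub>?K\<^esub> y"
      using Q.le_antisym by (auto simp: car le) (auto simp: copy_order_def)
  next
    fix x y z
    assume "x \<sqsubseteq>\<^bsub>?K\<^esub> y" "y \<sqsubseteq>\<^bsub>?K\<^esub> z" "x \<in> carrier ?K" "y \<in> carrier ?K" "z \<in> carrier ?K"
    then show "x \<sqsubseteq>\<^bsub>?K\<^esub> z" using Q.le_trans by (auto simp: car le)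
  \<comment> \<open>The definition is unfolded only under \<open>eq\<close>; the order stays folded
    so that \<open>le\<close> can rewrite it.\<close>
  qed (auto simp: car le copy_order_def[THEN arg_cong[of _ _ eq]])
  have rep: "\<exists>A \<subseteq> carrier Q. S = j ` A" if "S \<subseteq> carrier ?K" for S
    using that by (auto simp: car subset_image_iff)
  \<comment> \<open>Bounds in the copy are images of bounds in \<open>Q\<close>, so extremal bounds
    are transported by \<open>j\<close>.\<close>
  have lub: "least ?K (j (\<Squnion>\<^bsub>Q\<^esub>A)) (Upper ?K (j ` A))" if A: "A \<subseteq> carrier Q" for A
  proof (rule least_UpperI)
    fix y assume "y \<in> Upper ?K (j ` A)"
    then have y: "y \<in> j ` carrier Q" "\<And>a. a \<in> A \<Longrightarrow> j a \<sqsubseteq>\<^bsub>?K\<^esub> y"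
      using A by (auto simp: Upper_def car)
    then obtain x where x: "x \<in> carrier Q" "y = j x" by blast
    with y(2) have "a \<sqsubseteq>\<^bsub>Q\<^esub> x" if "a \<in> A" for a using that A le by blast
    then show "j (\<Squnion>\<^bsub>Q\<^esub>A) \<sqsubseteq>\<^bsub>?K\<^esub> y" using A x by (auto simp: le intro!: Q.sup_least)
  qed (use A in \<open>auto simp: car le subset_iff intro!: Q.sup_upper\<close>)
  have glb: "greatest ?K (j (\<Sqinter>\<^bsub>Q\<^esub>A)) (Lower ?K (j ` A))" if A: "A \<subseteq> carrier Q" for A
  proof (rule greatest_LowerI)
    fix y assume "y \<in> Lower ?K (j ` A)"
    then have y: "y \<in> j ` carrier Q" "\<And>a. a \<in> A \<Longrightarrow> y \<sqsubseteq>\<^bsub>?K\<^esub> j a"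
      using A by (auto simp: Lower_def car)
    then obtain x where x: "x \<in> carrier Q" "y = j x" by blast
    with y(2) have "x \<sqsubseteq>\<^bsub>Q\<^esub> a" if "a \<in> A" for a using that A le by blast
    then show "y \<sqsubseteq>\<^bsub>?K\<^esub> j (\<Sqinter>\<^bsub>Q\<^esub>A)" using A x by (auto simp: le intro!: Q.inf_greatest)
  qed (use A in \<open>auto simp: car le subset_iff intro!: Q.inf_lower\<close>)
  interpret K: complete_lattice ?K
  proof (rule K.complete_latticeI)
    fix S assume "S \<subseteq> carrier ?K"
    then obtain A where "A \<subseteq> carrier Q" "S = j ` A" using rep by blast
    then show "\<exists>s. least ?K s (Upper ?K S)" "\<exists>i. greatest ?K i (Lower ?K S)"
      using lub glb by auto
  qed
  have jc: "j x \<in> carrier ?K" if "x \<in> carrier Q" for x using that by (simp add: car)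
  have jsup: "j (\<Squnion>\<^bsub>Q\<^esub>A) = \<Squnion>\<^bsub>?K\<^esub>(j ` A)" if A: "A \<subseteq> carrier Q" for A
    using K.weak_least_unique[OF lub[OF A] K.sup_lub] A by (auto simp: car K.eq_is_equal)
  have jmeet: "j (x \<sqinter>\<^bsub>Q\<^esub> y) = j x \<sqinter>\<^bsub>?K\<^esub> j y" if xy: "x \<in> carrier Q" "y \<in> carrier Q" for x y
    by (rule K.meet_eqI[symmetric])
      (use xy in \<open>auto simp: car le intro: Q.meet_left Q.meet_right Q.meet_le\<close>)
  have jtop: "j \<top>\<^bsub>Q\<^esub> = \<top>\<^bsub>?K\<^esub>"
    by (rule K.top_eqI[symmetric]) (auto simp: car le)
  show "frame ?K"
  proof
    fix X S assume X: "X \<in> carrier ?K" and S: "S \<subseteq> carrier ?K"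
    obtain x where x: "x \<in> carrier Q" "X = j x" using X by (auto simp: car)
    obtain A where A: "A \<subseteq> carrier Q" "S = j ` A" using rep[OF S] by blast
    have "X \<sqinter>\<^bsub>?K\<^esub> \<Squnion>\<^bsub>?K\<^esub>S = j (\<Squnion>\<^bsub>Q\<^esub>((\<lambda>a. x \<sqinter>\<^bsub>Q\<^esub> a) ` A))"
      using x A by (simp flip: jsup jmeet Q.meet_sup_distrib)
    also have "\<dots> = \<Squnion>\<^bsub>?K\<^esub>(j ` (\<lambda>a. x \<sqinter>\<^bsub>Q\<^esub> a) ` A)"
      by (rule jsup) (use x A in auto)
    also have "j ` (\<lambda>a. x \<sqinter>\<^bsub>Q\<^esub> a) ` A = (\<lambda>Y. X \<sqinter>\<^bsub>?K\<^esub> Y) ` S"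
      unfolding A(2) x(2) image_image
      by (rule image_cong[OF refl]) (use x A in \<open>auto simp: jmeet\<close>)
    finally show "X \<sqinter>\<^bsub>?K\<^esub> \<Squnion>\<^bsub>?K\<^esub>S = \<Squnion>\<^bsub>?K\<^esub>((\<lambda>Y. X \<sqinter>\<^bsub>?K\<^esub> Y) ` S)" .
  qed
  show "(\<lambda>x \<in> carrier Q. j x) \<in> frame_hom Q ?K"
  proof (rule frame_homI)
    fix A assume A: "A \<subseteq> carrier Q"
    have "(\<lambda>x \<in> carrier Q. j x) ` A = j ` A" by (rule image_cong[OF refl]) (use A in auto)
    then show "(\<lambda>x \<in> carrier Q. j x) (\<Squnion>\<^bsub>Q\<^esub>A) = \<Squnion>\<^bsub>?K\<^esub>((\<lambda>x \<in> carrier Q. j x) ` A)"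
      using A jsup by simp
  qed (auto simp: jc jmeet jtop)
qed

section \<open>Finite joins of basic elements\<close>

lemma basic_elems_hom:
  assumes h: "h \<in> frame_hom (main B) (main B')"
    and B: "epos B \<in> frame_hom (pos B) (main B)" "eneg B \<in> frame_hom (neg B) (main B)"
    and f: "\<And>x. x \<in> carrier (pos B) \<Longrightarrow> f x \<in> carrier (pos B') \<and> h (epos B x) = epos B' (f x)"
    and g: "\<And>y. y \<in> carrier (neg B) \<Longrightarrow> g y \<in> carrier (neg B') \<and> h (eneg B y) = eneg B' (g y)"
    and b: "b \<in> basic_elems B"
  shows "h b \<in> basic_elems B'"
proof -
  obtain x y where xy: "x \<in> carrier (pos B)" "y \<in> carrier (neg B)"
      "b = epos B x \<sqinter>\<^bsub>main B\<^esub> eneg B y"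
    using b by (auto simp: basic_elems_def)
  then have "h b = epos B' (f x) \<sqinter>\<^bsub>main B'\<^esub> eneg B' (g y)"
    using frame_homD(3)[OF h] frame_homD(1)[OF B(1)] frame_homD(1)[OF B(2)] f g by simp
  then show ?thesis using f g xy(1,2) unfolding basic_elems_def by blast
qed

lemma basic_elems_carrier:
  assumes "complete_lattice (main B)" "epos B \<in> frame_hom (pos B) (main B)"
    "eneg B \<in> frame_hom (neg B) (main B)"
  shows "basic_elems B \<subseteq> carrier (main B)"
proof -
  interpret M: complete_lattice "main B" by fact
  show ?thesis
    using frame_homD(1)[OF assms(2)] frame_homD(1)[OF assms(3)] by (auto simp: basic_elems_def)
qed

lemma fin_elems_carrier:
  assumes "complete_lattice (main B)" "epos B \<in> frame_hom (pos B) (main B)"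
    "eneg B \<in> frame_hom (neg B) (main B)"
  shows "fin_elems B \<subseteq> carrier (main B)"
proof -
  interpret M: complete_lattice "main B" by fact
  show ?thesis
    using basic_elems_carrier[OF assms] by (auto simp: fin_elems_def)
qed

text \<open>A frame map compatible with the embeddings sends basic elements to basic elements and
  preserves joins, and the image of a finite set is finite. It is used for the map of coproducts
  induced by a biframe map.\<close>

lemma fin_elems_hom:
  assumes "complete_lattice (main B)" and h: "h \<in> frame_hom (main B) (main B')"
    and B: "epos B \<in> frame_hom (pos B) (main B)" "eneg B \<in> frame_hom (neg B) (main B)"
    and f: "\<And>x. x \<in> carrier (pos B) \<Longrightarrow> f x \<in> carrier (pos B') \<and> h (epos B x) = epos B' (f x)"
    and g: "\<And>y. y \<in> carrier (neg B) \<Longrightarrow> g y \<in> carrier (neg B') \<and> h (eneg B y) = eneg B' (g y)"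
    and b: "b \<in> fin_elems B"
  shows "h b \<in> fin_elems B'"
proof -
  obtain F where F: "finite F" "F \<subseteq> basic_elems B" "b = \<Squnion>\<^bsub>main B\<^esub>F"
    using b by (auto simp: fin_elems_def)
  have "F \<subseteq> carrier (main B)" using F basic_elems_carrier[OF assms(1) B] by blast
  then have "h b = \<Squnion>\<^bsub>main B'\<^esub>(h ` F)" using F frame_homD(2)[OF h] by simp
  moreover have "h ` F \<subseteq> basic_elems B'"
    using F basic_elems_hom[OF h B f g] by blast
  ultimately show ?thesis using F(1) by (auto simp: fin_elems_def)
qed

text \<open>Regrouping the four factors collects the positive parts and the negative parts, and each
  embedding preserves meets.\<close>

lemma basic_elems_meet:
  assumes "complete_lattice (main B)" "complete_lattice (pos B)" "complete_lattice (neg B)"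
    and e: "epos B \<in> frame_hom (pos B) (main B)" "eneg B \<in> frame_hom (neg B) (main B)"
    and "b \<in> basic_elems B" "c \<in> basic_elems B"
  shows "b \<sqinter>\<^bsub>main B\<^esub> c \<in> basic_elems B"
proof -
  interpret M: complete_lattice "main B" by fact
  interpret P: complete_lattice "pos B" by fact
  interpret N: complete_lattice "neg B" by fact
  obtain x y x' y' where xy: "x \<in> carrier (pos B)" "y \<in> carrier (neg B)"
      "x' \<in> carrier (pos B)" "y' \<in> carrier (neg B)"
      "b = epos B x \<sqinter>\<^bsub>main B\<^esub> eneg B y" "c = epos B x' \<sqinter>\<^bsub>main B\<^esub> eneg B y'"
    using assms(6,7) by (auto simp: basic_elems_def)
  have c: "epos B x \<in> carrier (main B)" "epos B x' \<in> carrier (main B)"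
      "eneg B y \<in> carrier (main B)" "eneg B y' \<in> carrier (main B)"
    using xy frame_homD(1)[OF e(1)] frame_homD(1)[OF e(2)] by auto
  have "b \<sqinter>\<^bsub>main B\<^esub> c =
      (epos B x \<sqinter>\<^bsub>main B\<^esub> epos B x') \<sqinter>\<^bsub>main B\<^esub> (eneg B y \<sqinter>\<^bsub>main B\<^esub> eneg B y')"
    unfolding xy(5,6) using c M.meet_assoc M.meet_closed meet_comm by metis
  also have "\<dots> = epos B (x \<sqinter>\<^bsub>pos B\<^esub> x') \<sqinter>\<^bsub>main B\<^esub> eneg B (y \<sqinter>\<^bsub>neg B\<^esub> y')"
    using xy frame_homD(3)[OF e(1)] frame_homD(3)[OF e(2)] by simp
  finally show ?thesis
    using xy P.meet_closed N.meet_closed unfolding basic_elems_def by blast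
qed

lemma fin_elems_meet:
  assumes "frame (main B)" "complete_lattice (pos B)" "complete_lattice (neg B)"
    and e: "epos B \<in> frame_hom (pos B) (main B)" "eneg B \<in> frame_hom (neg B) (main B)"
    and "b \<in> fin_elems B" "c \<in> fin_elems B"
  shows "b \<sqinter>\<^bsub>main B\<^esub> c \<in> fin_elems B"
proof -
  interpret M: frame "main B" by fact
  obtain F G where FG: "finite F" "F \<subseteq> basic_elems B" "b = \<Squnion>\<^bsub>main B\<^esub>F"
      "finite G" "G \<subseteq> basic_elems B" "c = \<Squnion>\<^bsub>main B\<^esub>G"
    using assms(6,7) by (auto simp: fin_elems_def)
  have "F \<subseteq> carrier (main B)" "G \<subseteq> carrier (main B)"
    using FG basic_elems_carrier[OF M.complete_lattice_axioms e] by blast+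
  then have "b \<sqinter>\<^bsub>main B\<^esub> c = \<Squnion>\<^bsub>main B\<^esub>((\<lambda>(x, y). x \<sqinter>\<^bsub>main B\<^esub> y) ` (F \<times> G))"
    unfolding FG(3,6) by (rule M.sup_meet_sup)
  moreover have "(\<lambda>(x, y). x \<sqinter>\<^bsub>main B\<^esub> y) ` (F \<times> G) \<subseteq> basic_elems B"
    using FG basic_elems_meet[OF M.complete_lattice_axioms assms(2,3) e] by auto
  ultimately show ?thesis
    using FG(1,4) unfolding fin_elems_def by blast
qed

section \<open>The finitary coreflection of a biframe\<close>

abbreviation coprod_main :: "('a, 'b, 'l) biframe \<Rightarrow> ('a \<times> 'b) set gorder" where
  "coprod_main B \<equiv> coprod (pos B) (neg B)"

abbreviation canonical_map :: "('a, 'b, 'l) biframe \<Rightarrow> ('a \<times> 'b) set \<Rightarrow> 'l" where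
  "canonical_map B \<equiv> copair (pos B) (neg B) (main B) (epos B) (eneg B)"

text \<open>The projection of the coproduct onto the main component of
  \<open>fin_biframe j B\<close>: the quotient map followed by the transport along \<open>j\<close>.
  It turns out to be the canonical map of that biframe.\<close>

definition fin_proj ::
    "(('a \<times> 'b) set set \<Rightarrow> 'l) \<Rightarrow> ('a, 'b, 'l) biframe \<Rightarrow> ('a \<times> 'b) set \<Rightarrow> 'l" where
  "fin_proj j B = compose (carrier (coprod_main B))
     (\<lambda>X \<in> carrier (quot_frame (coprod_main B) (fin_cong B)). j X)
     (quot_map (coprod_main B) (fin_cong B))"

section \<open>The canonical map of a biframe and the finitary part of its kernel\<close>

locale biframe_struct =
  fixes B :: "('a, 'b, 'l) biframe"
  assumes biframe: "is_biframe B"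
begin

lemma frames: "frame (pos B)" "frame (neg B)" "frame (main B)"
  and emb: "epos B \<in> frame_hom (pos B) (main B)" "eneg B \<in> frame_hom (neg B) (main B)"
  and emb_inj: "inj_on (epos B) (carrier (pos B))" "inj_on (eneg B) (carrier (neg B))"
  and dense: "\<And>x. x \<in> carrier (main B) \<Longrightarrow> \<exists>S \<subseteq> basic_elems B. x = \<Squnion>\<^bsub>main B\<^esub>S"
  using biframe by (auto simp: is_biframe_def)

lemmas completes = frames[THEN frame_complete]

sublocale frame_pair "pos B" "neg B"
  using frames by (simp add: frame_pair_def)

lemma completeP: "complete_lattice P"
  by (rule complete_lattice_P)

lemma coprod_biframe_simps [simp]:
  "pos (coprod_biframe B) = pos B" "neg (coprod_biframe B) = neg B"
  "main (coprod_biframe B) = P" "epos (coprod_biframe B) = in1" "eneg (coprod_biframe B) = in2"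
  by (simp_all add: coprod_biframe_def)

lemmas canonical = copair_props[OF frames emb]

text \<open>Each basic element is the image of a meet of injected elements, every element is a join
  of basic ones, and the canonical map preserves joins.\<close>

lemma canonical_surj: "canonical_map B ` carrier P = carrier (main B)"
proof
  show "canonical_map B ` carrier P \<subseteq> carrier (main B)"
    using frame_homD(1)[OF canonical(1)] by blast
  show "carrier (main B) \<subseteq> canonical_map B ` carrier P"
  proof
    fix x assume "x \<in> carrier (main B)"
    then obtain S where S: "S \<subseteq> basic_elems B" "x = \<Squnion>\<^bsub>main B\<^esub>S" using dense by blast
    define T where "T = {U \<in> carrier P. canonical_map B U \<in> S}"
    have "s \<in> canonical_map B ` T" if s: "s \<in> S" for s
    proof -
      obtain a b where ab: "a \<in> carrier (pos B)" "b \<in> carrier (neg B)"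
          "s = epos B a \<sqinter>\<^bsub>main B\<^esub> eneg B b"
        using s S by (auto simp: basic_elems_def)
      have U: "in1 a \<sqinter>\<^bsub>P\<^esub> in2 b \<in> carrier P"
        using ab by (simp add: in1_meet_in2 rect_cideal)
      have "canonical_map B (in1 a \<sqinter>\<^bsub>P\<^esub> in2 b) = s"
        using ab frame_homD(3)[OF canonical(1)] canonical(2,3) in1_closed in2_closed by simp
      then show ?thesis using U s by (force simp: T_def)
    qed
    then have "S = canonical_map B ` T" by (auto simp: T_def)
    moreover have T: "T \<subseteq> carrier P" by (auto simp: T_def)
    ultimately have "x = canonical_map B (\<Squnion>\<^bsub>P\<^esub>T)"
      using S(2) frame_homD(2)[OF canonical(1)] by simp
    then show "x \<in> canonical_map B ` carrier P" using P_sup_closed T by auto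
  qed
qed

lemma kernel_congruence: "frame_congruence P (coprod_kernel B)"
  unfolding coprod_kernel_def by (rule frame_congruence_hom_kernel[OF frame_P frames(3) canonical(1)])

abbreviation "fin_rel \<equiv>
  coprod_kernel B \<inter> fin_elems (coprod_biframe B) \<times> fin_elems (coprod_biframe B)"

lemma fin_elems_P: "fin_elems (coprod_biframe B) \<subseteq> carrier P"
  using fin_elems_carrier[of "coprod_biframe B"] completeP in1_hom in2_hom by simp

lemma fin_rel_carrier: "fin_rel \<subseteq> carrier P \<times> carrier P"
  using fin_elems_P by blast

sublocale fc: frame_with_congruence "P" "fin_cong B"
  using frame_congruence_gen(1)[OF frame_P fin_rel_carrier] frame_P
  by (simp add: frame_with_congruence_def frame_with_congruence_axioms_def fin_cong_def)

lemma fin_cong_rel: "(a, b) \<in> fin_rel \<Longrightarrow> (a \<sqinter>\<^bsub>P\<^esub> b, a) \<in> fin_cong B"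
  using frame_congruence_gen(2)[OF frame_P fin_rel_carrier] by (simp add: fin_cong_def)

text \<open>A pair \<open>(a, b)\<close> identified by the kernel also satisfies the inequality it
  imposes: meeting \<open>(a, a)\<close> with \<open>(b, a)\<close> gives
  \<open>(a \<sqinter> b, a)\<close>.\<close>

lemma fin_cong_le_kernel: "fin_cong B \<subseteq> coprod_kernel B"
  unfolding fin_cong_def
proof (rule gen_congruence_least[OF kernel_congruence])
  interpret k: frame_with_congruence P "coprod_kernel B"
    using kernel_congruence frame_P
    by (simp add: frame_with_congruence_def frame_with_congruence_axioms_def)
  fix a b assume "(a, b) \<in> fin_rel"
  then have ab: "(a, b) \<in> coprod_kernel B" by blast
  then have "a \<in> carrier P" using k.C_carrier by blast
  moreover from this have "a \<sqinter>\<^bsub>P\<^esub> a = a" using fc.le_iff_meet_eq fc.le_refl by blast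
  ultimately show "(a \<sqinter>\<^bsub>P\<^esub> b, a) \<in> coprod_kernel B"
    using k.C_meet[OF k.C_refl[of a] k.C_sym[OF ab]] by simp
qed

lemma fin_cong_finitary:
  assumes "is_finitary B"
  shows "fin_cong B = coprod_kernel B"
proof
  obtain R where R: "R \<subseteq> fin_elems (coprod_biframe B) \<times> fin_elems (coprod_biframe B)"
      "coprod_kernel B = gen_congruence P R"
    using assms by (auto simp: is_finitary_def finitary_congruence_def)
  have RP: "R \<subseteq> carrier P \<times> carrier P" using R(1) fin_elems_P by blast
  interpret k: frame_with_congruence P "coprod_kernel B"
    using kernel_congruence frame_P
    by (simp add: frame_with_congruence_def frame_with_congruence_axioms_def)
  show "coprod_kernel B \<subseteq> fin_cong B"
    unfolding R(2)
  proof (rule gen_congruence_least[OF fc.cong])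
    fix a b assume ab: "(a, b) \<in> R"
    then have fin: "a \<in> fin_elems (coprod_biframe B)" "b \<in> fin_elems (coprod_biframe B)"
      using R(1) by auto
    then have c: "a \<in> carrier P" "b \<in> carrier P" using fin_elems_P by auto
    have "a \<sqinter>\<^bsub>P\<^esub> b \<in> fin_elems (coprod_biframe B)"
      using fin_elems_meet[of "coprod_biframe B" a b] fin frame_P completes
        in1_hom in2_hom by simp
    \<comment> \<open>Since \<open>R\<close> lists inequalities, \<open>(a, b)\<close> itself may
      fail to lie in the kernel, but this pair does.\<close>
    moreover have "(a, a \<sqinter>\<^bsub>P\<^esub> b) \<in> coprod_kernel B"
      using k.C_sym frame_congruence_gen(2)[OF frame_P RP ab] R(2) by metis
    \<comment> \<open>The new pair is read as the inequality \<open>a \<le> a \<sqinter> b\<close>;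
      idempotence then recovers the one for \<open>(a, b)\<close>.\<close>
    ultimately have "(a \<sqinter>\<^bsub>P\<^esub> (a \<sqinter>\<^bsub>P\<^esub> b), a) \<in> fin_cong B"
      using fin by (intro fin_cong_rel) auto
    moreover have "a \<sqinter>\<^bsub>P\<^esub> (a \<sqinter>\<^bsub>P\<^esub> b) = a \<sqinter>\<^bsub>P\<^esub> b"
      using c P_meet cideals_Int by auto
    ultimately show "(a \<sqinter>\<^bsub>P\<^esub> b, a) \<in> fin_cong B" by simp
  qed
qed (rule fin_cong_le_kernel)

section \<open>The biframe \<open>fin_biframe j B\<close> and its projection from the
  coproduct\<close>

context
  fixes j :: "('a \<times> 'b) set set \<Rightarrow> 'l"
  assumes j: "inj j"
begin

lemma fin_biframe_simps:
  "pos (fin_biframe j B) = pos B" "neg (fin_biframe j B) = neg B"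
  "main (fin_biframe j B) = copy_order j fc.Q"
  by (simp_all add: fin_biframe_def Let_def)

lemma inj_on_j: "inj_on j A"
  using j by (rule inj_on_subset) simp

lemma fin_frame: "frame (main (fin_biframe j B))"
  using frame_copy_order[OF fc.frame_Q inj_on_j] by (simp add: fin_biframe_simps)

lemma fin_proj_eq: "U \<in> carrier P \<Longrightarrow> fin_proj j B U = j (fc.q U)"
  using fc.q_carrier by (simp add: fin_proj_def compose_def)

lemma fin_proj_hom: "fin_proj j B \<in> frame_hom P (main (fin_biframe j B))"
  unfolding fin_proj_def fin_biframe_simps
  by (rule frame_hom_compose[OF completeP fc.q_hom frame_hom_copy_order[OF fc.frame_Q inj_on_j]])

lemma fin_proj_surj: "fin_proj j B ` carrier P = carrier (main (fin_biframe j B))"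
proof -
  have "fin_proj j B ` carrier P = j ` fc.q ` carrier P"
    unfolding image_image by (rule image_cong[OF refl]) (rule fin_proj_eq)
  also have "fc.q ` carrier P = carrier fc.Q"
    using fc.q_carrier by (auto elim!: fc.q_surj)
  finally show ?thesis by (simp add: fin_biframe_simps copy_order_def)
qed

text \<open>Injectivity of \<open>j\<close> means that the transport identifies nothing
  further.\<close>

lemma fin_proj_kernel: "hom_kernel P (fin_proj j B) = fin_cong B"
proof -
  have "hom_kernel P (fin_proj j B) = hom_kernel P fc.q"
    using inj_eq[OF j] by (auto simp: hom_kernel_def fin_proj_eq simp del: P_simps)
  then show ?thesis by (simp add: fc.hom_kernel_quot_map)
qed

lemma fin_proj_in:
  "x \<in> carrier (pos B) \<Longrightarrow> epos (fin_biframe j B) x = fin_proj j B (in1 x)"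
  "y \<in> carrier (neg B) \<Longrightarrow> eneg (fin_biframe j B) y = fin_proj j B (in2 y)"
  by (simp_all add: fin_biframe_def Let_def fin_proj_eq in1_closed in2_closed)

lemma fin_emb:
  "epos (fin_biframe j B) \<in> frame_hom (pos B) (main (fin_biframe j B))"
  "eneg (fin_biframe j B) \<in> frame_hom (neg B) (main (fin_biframe j B))"
proof -
  have "epos (fin_biframe j B) = compose (carrier (pos B)) (fin_proj j B) in1"
    by (rule extensionalityI[of _ "carrier (pos B)"])
      (auto simp: compose_def fin_proj_in, simp add: fin_biframe_def Let_def)
  then show "epos (fin_biframe j B) \<in> frame_hom (pos B) (main (fin_biframe j B))"
    using frame_hom_compose[OF completes(1) in1_hom fin_proj_hom] by simp
  have "eneg (fin_biframe j B) = compose (carrier (neg B)) (fin_proj j B) in2"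
    by (rule extensionalityI[of _ "carrier (neg B)"])
      (auto simp: compose_def fin_proj_in, simp add: fin_biframe_def Let_def)
  then show "eneg (fin_biframe j B) \<in> frame_hom (neg B) (main (fin_biframe j B))"
    using frame_hom_compose[OF completes(2) in2_hom fin_proj_hom] by simp
qed

text \<open>The embeddings are injective because elements identified by \<open>fin_proj\<close> are
  identified by the canonical map, which restricts to the injective embeddings of \<open>B\<close>.
  Density is inherited from the coproduct, where every C-ideal is a join of rectangles.\<close>

lemma is_biframe_fin: "is_biframe (fin_biframe j B)"
  unfolding is_biframe_def
proof (intro conjI ballI)
  have ker: "canonical_map B U = canonical_map B V"
    if "U \<in> carrier P" "V \<in> carrier P" "fin_proj j B U = fin_proj j B V" for U V
  proof -
    have "(U, V) \<in> hom_kernel P (fin_proj j B)" using that by (simp add: hom_kernel_def)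
    then have "(U, V) \<in> coprod_kernel B" using fin_proj_kernel fin_cong_le_kernel by blast
    then show ?thesis by (simp add: coprod_kernel_def hom_kernel_def)
  qed
  show "inj_on (epos (fin_biframe j B)) (carrier (pos (fin_biframe j B)))"
    unfolding fin_biframe_simps
  proof (rule inj_onI)
    fix x y assume xy: "x \<in> carrier (pos B)" "y \<in> carrier (pos B)"
      "epos (fin_biframe j B) x = epos (fin_biframe j B) y"
    then have "canonical_map B (in1 x) = canonical_map B (in1 y)"
      by (intro ker) (auto simp: fin_proj_in in1_closed)
    then show "x = y" using xy canonical(2) emb_inj(1) by (auto dest: inj_onD)
  qed
  show "inj_on (eneg (fin_biframe j B)) (carrier (neg (fin_biframe j B)))"
    unfolding fin_biframe_simps
  proof (rule inj_onI)
    fix x y assume xy: "x \<in> carrier (neg B)" "y \<in> carrier (neg B)"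
      "eneg (fin_biframe j B) x = eneg (fin_biframe j B) y"
    then have "canonical_map B (in2 x) = canonical_map B (in2 y)"
      by (intro ker) (auto simp: fin_proj_in in2_closed)
    then show "x = y" using xy canonical(3) emb_inj(2) by (auto dest: inj_onD)
  qed
  fix x assume "x \<in> carrier (main (fin_biframe j B))"
  then obtain U where U: "U \<in> cideals (pos B) (neg B)" "x = fin_proj j B U"
    using fin_proj_surj by auto
  \<comment> \<open>The rectangles whose join is \<open>U\<close>; their projections are basic
    elements.\<close>
  define T where "T = (\<lambda>(a, b). in1 a \<sqinter>\<^bsub>P\<^esub> in2 b) ` U"
  have c: "a \<in> carrier (pos B) \<and> b \<in> carrier (neg B)" if "(a, b) \<in> U" for a b
    using that cidealsD(1)[OF U(1)] by blast
  have TP: "T \<subseteq> carrier P"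
    using c by (auto simp: T_def in1_meet_in2 rect_cideal)
  have "U = \<Squnion>\<^bsub>P\<^esub>T" unfolding T_def using cideal_eq_sup[OF U(1)] by simp
  then have "x = \<Squnion>\<^bsub>main (fin_biframe j B)\<^esub>(fin_proj j B ` T)"
    using U(2) frame_homD(2)[OF fin_proj_hom TP] by simp
  moreover have "fin_proj j B ` T \<subseteq> basic_elems (fin_biframe j B)"
  proof
    fix z assume "z \<in> fin_proj j B ` T"
    then obtain a b where ab: "(a, b) \<in> U" "z = fin_proj j B (in1 a \<sqinter>\<^bsub>P\<^esub> in2 b)"
      by (auto simp: T_def)
    then have "z = epos (fin_biframe j B) a \<sqinter>\<^bsub>main (fin_biframe j B)\<^esub> eneg (fin_biframe j B) b"
      using c[OF ab(1)] frame_homD(3)[OF fin_proj_hom]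
      by (simp add: fin_proj_in in1_closed in2_closed)
    then show "z \<in> basic_elems (fin_biframe j B)"
      using c[OF ab(1)] by (auto simp: basic_elems_def fin_biframe_simps(1,2))
  qed
  ultimately show "\<exists>S \<subseteq> basic_elems (fin_biframe j B). x = \<Squnion>\<^bsub>main (fin_biframe j B)\<^esub>S"
    by blast
qed (use frames fin_frame fin_emb in \<open>auto simp: fin_biframe_simps(1,2)\<close>)

text \<open>Both maps agree on the two injections. This identifies the coproduct kernel of the new
  biframe with \<open>fin_cong B\<close>.\<close>

lemma canonical_fin_biframe: "canonical_map (fin_biframe j B) = fin_proj j B"
proof (rule coprod_hom_eqI[OF frames(1,2) fin_frame _ fin_proj_hom])
  note props = copair_props[OF frames(1,2) fin_frame fin_emb]
  show "canonical_map (fin_biframe j B) \<in> frame_hom P (main (fin_biframe j B))"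
    using props(1) by (simp add: fin_biframe_simps(1,2))
  show "canonical_map (fin_biframe j B) (in1 a) = fin_proj j B (in1 a)"
    if "a \<in> carrier (pos B)" for a
    using props(2)[OF that] fin_proj_in(1)[OF that] by (simp add: fin_biframe_simps(1,2))
  show "canonical_map (fin_biframe j B) (in2 b) = fin_proj j B (in2 b)"
    if "b \<in> carrier (neg B)" for b
    using props(3)[OF that] fin_proj_in(2)[OF that] by (simp add: fin_biframe_simps(1,2))
qed

text \<open>The positive and negative components are unchanged, hence so are the coproduct and its
  finite elements; the new kernel is generated by \<open>fin_rel\<close> by definition.\<close>

lemma is_finitary_fin: "is_finitary (fin_biframe j B)"
proof -
  have "coprod_kernel (fin_biframe j B) = fin_cong B"
    unfolding coprod_kernel_def canonical_fin_biframe
    by (simp add: fin_biframe_simps(1,2) fin_proj_kernel)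
  moreover have "coprod_biframe (fin_biframe j B) = coprod_biframe B"
    by (simp add: coprod_biframe_def fin_biframe_simps(1,2))
  ultimately show ?thesis
    unfolding is_finitary_def finitary_congruence_def
    by (intro exI[of _ fin_rel]) (auto simp: fin_cong_def)
qed

section \<open>The identity pairs as counit and unit\<close>

lemma id_hom_pos_neg:
  "(\<lambda>x \<in> carrier (pos B). x) \<in> frame_hom (pos B) (pos B)"
  "(\<lambda>x \<in> carrier (neg B). x) \<in> frame_hom (neg B) (neg B)"
  using completes[THEN frame_hom_id] by simp_all

text \<open>The main component is the factor of the canonical map through \<open>fin_proj\<close>,
  which exists because \<open>fin_cong B\<close> lies in the kernel.\<close>

lemma counit_hom: "id_map B \<in> biframe_hom (fin_biframe j B) B"
proof -
  obtain g where g: "g \<in> frame_hom (main (fin_biframe j B)) (main B)"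
      "\<And>U. U \<in> carrier P \<Longrightarrow> g (fin_proj j B U) = canonical_map B U"
    using frame_hom_factor[OF completeP fin_proj_hom fin_proj_surj canonical(1)]
      fin_cong_le_kernel unfolding fin_proj_kernel coprod_kernel_def by blast
  show ?thesis
    unfolding biframe_hom_def id_map_def using g id_hom_pos_neg canonical(2,3)
    by (auto simp: fin_biframe_simps(1,2) fin_proj_in in1_closed in2_closed intro!: bexI[OF _ g(1)])
qed

text \<open>Here \<open>fin_proj\<close> is factored through the canonical map, in the opposite
  direction. This needs the reverse inclusion of kernels, which finitariness supplies.\<close>

lemma unit_hom:
  assumes "is_finitary B"
  shows "id_map B \<in> biframe_hom B (fin_biframe j B)"
proof -
  have "hom_kernel P (canonical_map B) = hom_kernel P (fin_proj j B)"
    unfolding fin_proj_kernel fin_cong_finitary[OF assms] coprod_kernel_def by simp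
  then obtain g where g: "g \<in> frame_hom (main B) (main (fin_biframe j B))"
      "\<And>U. U \<in> carrier P \<Longrightarrow> g (canonical_map B U) = fin_proj j B U"
    using frame_hom_factor[OF completeP canonical(1) canonical_surj fin_proj_hom] by blast
  have "g (epos B x) = fin_proj j B (in1 x)" if "x \<in> carrier (pos B)" for x
    using g(2)[of "in1 x"] that canonical(2) in1_closed by simp
  moreover have "g (eneg B y) = fin_proj j B (in2 y)" if "y \<in> carrier (neg B)" for y
    using g(2)[of "in2 y"] that canonical(3) in2_closed by simp
  ultimately show ?thesis
    unfolding biframe_hom_def id_map_def using id_hom_pos_neg
    by (auto simp: fin_biframe_simps(1,2) fin_proj_in intro!: bexI[OF _ g(1)])
qed

end

end

text \<open>The map \<open>h\<close> between the original main components does not act on the finer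
  quotients. One works instead with the induced map \<open>F\<close> of coproducts and lets it
  descend; \<open>h\<close> only serves to show that \<open>F\<close> respects the kernels.\<close>

lemma fin_biframe_hom:
  fixes j :: "('a \<times> 'b) set set \<Rightarrow> 'l" and j' :: "('c \<times> 'd) set set \<Rightarrow> 'm"
  assumes "is_biframe B" "is_biframe B'" "inj j" "inj j'"
    and "(f, g) \<in> biframe_hom B B'"
  shows "(f, g) \<in> biframe_hom (fin_biframe j B) (fin_biframe j' B')"
proof -
  interpret B: biframe_struct B by unfold_locales fact
  interpret B': biframe_struct B' by unfold_locales fact
  note simps = B.fin_biframe_simps(1,2)[OF assms(3)] B'.fin_biframe_simps(1,2)[OF assms(4)]
  obtain h where f: "f \<in> frame_hom (pos B) (pos B')" and g: "g \<in> frame_hom (neg B) (neg B')"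
    and h: "h \<in> frame_hom (main B) (main B')"
      "\<And>x. x \<in> carrier (pos B) \<Longrightarrow> h (epos B x) = epos B' (f x)"
      "\<And>y. y \<in> carrier (neg B) \<Longrightarrow> h (eneg B y) = eneg B' (g y)"
    using assms(5) by (auto simp: biframe_hom_def)
  note fc = frame_homD(1)[OF f] and gc = frame_homD(1)[OF g]
  have "compose (carrier (pos B)) B'.in1 f \<in> frame_hom (pos B) B'.P"
      "compose (carrier (neg B)) B'.in2 g \<in> frame_hom (neg B) B'.P"
    using frame_hom_compose[OF _ f B'.in1_hom] frame_hom_compose[OF _ g B'.in2_hom]
      frame_complete B.frames by auto
  from B.coprod_universal[OF B'.frame_P this]
  \<comment> \<open>\<open>F\<close> is the coproduct of \<open>f\<close> and
    \<open>g\<close>.\<close>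
  obtain F where F: "F \<in> frame_hom B.P B'.P"
      "\<And>x. x \<in> carrier (pos B) \<Longrightarrow> F (B.in1 x) = B'.in1 (f x)"
      "\<And>y. y \<in> carrier (neg B) \<Longrightarrow> F (B.in2 y) = B'.in2 (g y)"
    by (auto simp: compose_def)
  \<comment> \<open>Naturality of the canonical maps; it suffices to compare on the
    injections.\<close>
  have comm: "compose (carrier B.P) (canonical_map B') F = compose (carrier B.P) h (canonical_map B)"
    by (rule coprod_hom_eqI[OF B.frames(1,2) B'.frames(3)
          frame_hom_compose[OF B.completeP F(1) B'.canonical(1)]
          frame_hom_compose[OF B.completeP B.canonical(1) h(1)]])
      (auto simp: compose_def B.in1_closed B.in2_closed F h fc gc B.canonical(2,3) B'.canonical(2,3))
  have Ffin: "F a \<in> fin_elems (coprod_biframe B')" if "a \<in> fin_elems (coprod_biframe B)" for a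
    by (rule fin_elems_hom[of "coprod_biframe B" F _ f g])
      (use that F fc gc B.completeP B.in1_hom B.in2_hom in auto)
  \<comment> \<open>The required map of main components is the factor of \<open>k\<close> through
    \<open>fin_proj j B\<close>, so \<open>k\<close> has to respect the generators of
    \<open>fin_cong B\<close>.\<close>
  define k where "k = compose (carrier B.P) (fin_proj j' B') F"
  have k: "k \<in> frame_hom B.P (main (fin_biframe j' B'))"
    unfolding k_def by (rule frame_hom_compose[OF B.completeP F(1) B'.fin_proj_hom[OF assms(4)]])
  have "fin_cong B \<subseteq> hom_kernel B.P k"
    unfolding fin_cong_def
  proof (rule gen_congruence_least)
    show "frame_congruence B.P (hom_kernel B.P k)"
      by (rule frame_congruence_hom_kernel[OF B.frame_P B'.fin_frame[OF assms(4)] k])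
    fix a b assume ab: "(a, b) \<in> B.fin_rel"
    then have c: "a \<in> carrier B.P" "b \<in> carrier B.P" using B.fin_rel_carrier by blast+
    have "canonical_map B a = canonical_map B b"
      using ab by (simp add: coprod_kernel_def hom_kernel_def)
    then have "canonical_map B' (F a) = canonical_map B' (F b)"
      using fun_cong[OF comm, of a] fun_cong[OF comm, of b] c by (simp add: compose_def)
    \<comment> \<open>By \<open>comm\<close> the images are identified in the kernel of
      \<open>B'\<close>, and by \<open>Ffin\<close> they are still finite, so they form a generator
      of \<open>fin_cong B'\<close>.\<close>
    then have "(F a, F b) \<in> B'.fin_rel"
      using ab Ffin frame_homD(1)[OF F(1)] c by (auto simp: coprod_kernel_def hom_kernel_def)
    then have "(F (a \<sqinter>\<^bsub>B.P\<^esub> b), F a) \<in> hom_kernel B'.P (fin_proj j' B')"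
      using B'.fin_cong_rel frame_homD(3)[OF F(1)] c
      unfolding B'.fin_proj_kernel[OF assms(4)] by simp
    moreover have "a \<sqinter>\<^bsub>B.P\<^esub> b \<in> carrier B.P" using c B.fc.meet_closed by blast
    ultimately show "(a \<sqinter>\<^bsub>B.P\<^esub> b, a) \<in> hom_kernel B.P k"
      using c by (simp add: hom_kernel_def k_def compose_def)
  qed
  then obtain m where m: "m \<in> frame_hom (main (fin_biframe j B)) (main (fin_biframe j' B'))"
      "\<And>U. U \<in> carrier B.P \<Longrightarrow> m (fin_proj j B U) = k U"
    using frame_hom_factor[OF B.completeP B.fin_proj_hom[OF assms(3)] B.fin_proj_surj[OF assms(3)] k]
    unfolding B.fin_proj_kernel[OF assms(3)] by blast
  show ?thesis
    unfolding biframe_hom_def using f g F(2,3) fc gc m(2)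
    by (auto simp: simps B.fin_proj_in[OF assms(3)] B'.fin_proj_in[OF assms(4)] k_def compose_def
        B.in1_closed B.in2_closed intro!: bexI[OF _ m(1)])
qed

section \<open>The adjunction\<close>

lemma id_map_hom: "is_biframe B \<Longrightarrow> id_map B \<in> biframe_hom B B"
proof -
  assume "is_biframe B"
  then interpret biframe_struct B by unfold_locales
  show ?thesis
    unfolding biframe_hom_def id_map_def
    using completes[THEN frame_hom_id] frame_homD(1)[OF emb(1)] frame_homD(1)[OF emb(2)]
    by (auto intro!: bexI[of _ "\<lambda>x \<in> carrier (main B). x"])
qed

lemma biframe_hom_compose:
  assumes "is_biframe X" and f: "f \<in> biframe_hom X Y" and g: "g \<in> biframe_hom Y Z"
  shows "Cmp BiFrm X Y Z g f \<in> biframe_hom X Z"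
proof -
  interpret biframe_struct X by unfold_locales fact
  obtain f1 f2 f0 where F: "f = (f1, f2)" "f1 \<in> frame_hom (pos X) (pos Y)"
      "f2 \<in> frame_hom (neg X) (neg Y)" "f0 \<in> frame_hom (main X) (main Y)"
      "\<And>x. x \<in> carrier (pos X) \<Longrightarrow> f0 (epos X x) = epos Y (f1 x)"
      "\<And>x. x \<in> carrier (neg X) \<Longrightarrow> f0 (eneg X x) = eneg Y (f2 x)"
    using f by (auto simp: biframe_hom_def)
  obtain g1 g2 g0 where G: "g = (g1, g2)" "g1 \<in> frame_hom (pos Y) (pos Z)"
      "g2 \<in> frame_hom (neg Y) (neg Z)" "g0 \<in> frame_hom (main Y) (main Z)"
      "\<And>x. x \<in> carrier (pos Y) \<Longrightarrow> g0 (epos Y x) = epos Z (g1 x)"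
      "\<And>x. x \<in> carrier (neg Y) \<Longrightarrow> g0 (eneg Y x) = eneg Z (g2 x)"
    using g by (auto simp: biframe_hom_def)
  have "compose (carrier (main X)) g0 f0 \<in> frame_hom (main X) (main Z)"
      "compose (carrier (pos X)) g1 f1 \<in> frame_hom (pos X) (pos Z)"
      "compose (carrier (neg X)) g2 f2 \<in> frame_hom (neg X) (neg Z)"
    using frame_hom_compose frame_complete frames F G by blast+
  then show ?thesis
    unfolding biframe_hom_def BiFrm_def F(1) G(1)
    using F(5,6) G(5,6) frame_homD(1)[OF F(2)] frame_homD(1)[OF F(3)]
      frame_homD(1)[OF emb(1)] frame_homD(1)[OF emb(2)]
    by (auto simp: compose_def intro!: bexI[of _ "compose (carrier (main X)) g0 f0"])
qed

lemma biframe_homD: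
  assumes "f \<in> biframe_hom X Y"
  shows "fst f \<in> carrier (pos X) \<rightarrow>\<^sub>E carrier (pos Y)" "snd f \<in> carrier (neg X) \<rightarrow>\<^sub>E carrier (neg Y)"
  using assms by (auto simp: biframe_hom_def frame_hom_def)

text \<open>Extensionality of \<open>f\<close> makes these equalities of total functions.\<close>

lemma compose_id:
  assumes "f \<in> A \<rightarrow>\<^sub>E B"
  shows "compose A (\<lambda>x \<in> B. x) f = f" "compose A f (\<lambda>x \<in> A. x) = f"
  using assms by (auto simp: compose_def fun_eq_iff PiE_def Pi_def extensional_def)

lemmas biframe_hom_compose_id =
  compose_id[OF biframe_homD(1)] compose_id[OF biframe_homD(2)]

lemma BiFrm_simps:
  "Ob BiFrm = {B. is_biframe B}" "Hom BiFrm = biframe_hom" "Idt BiFrm = id_map"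
  "Ob BiFrm_fin = {B. is_biframe B \<and> is_finitary B}" "Hom BiFrm_fin = biframe_hom"
  "Idt BiFrm_fin = id_map" "Cmp BiFrm_fin = Cmp BiFrm"
  by (simp_all add: BiFrm_def BiFrm_fin_def full_subcat_def)

lemma Cmp_id_map:
  assumes "f \<in> biframe_hom X Y"
  shows "Cmp BiFrm X Y Y (id_map Y) f = f" "Cmp BiFrm X X Y f (id_map X) = f"
  using biframe_hom_compose_id[OF assms] by (simp_all add: BiFrm_def id_map_def)

lemma category_BiFrm: "category BiFrm"
  unfolding category_def
proof (intro conjI ballI)
  fix W X Y Z and f g h
  assume "f \<in> Hom BiFrm W X" "g \<in> Hom BiFrm X Y" "h \<in> Hom BiFrm Y Z"
  \<comment> \<open>Associativity of \<open>compose\<close> only asks that the innermost map land in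
    the right carrier.\<close>
  then have "f \<in> biframe_hom W X" by (simp add: BiFrm_def)
  then have "fst f \<in> carrier (pos W) \<rightarrow> carrier (pos X)" "snd f \<in> carrier (neg W) \<rightarrow> carrier (neg X)"
    using biframe_homD[of f W X] by auto
  then show "Cmp BiFrm W X Z (Cmp BiFrm X Y Z h g) f = Cmp BiFrm W Y Z h (Cmp BiFrm W X Y g f)"
    by (simp add: BiFrm_def compose_assoc)
qed (simp_all add: BiFrm_simps id_map_hom Cmp_id_map biframe_hom_compose)

lemma category_full_subcat: "category C \<Longrightarrow> category (full_subcat C P)"
  unfolding category_def full_subcat_def by simp

lemma category_BiFrm_fin: "category BiFrm_fin"
  unfolding BiFrm_fin_def by (rule category_full_subcat[OF category_BiFrm])

theorem proposition3p17:
  fixes j :: "('a \<times> 'b) set set \<Rightarrow> 'l"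
  assumes "inj j"
  shows "adjunction (BiFrm_fin :: (('a, 'b, 'l) biframe, ('a, 'b) biframe_map) cat) BiFrm
    incl_functor (fin_functor j) id_map id_map"
proof -
  let ?C = "BiFrm_fin :: (('a, 'b, 'l) biframe, ('a, 'b) biframe_map) cat"
  let ?D = "BiFrm :: (('a, 'b, 'l) biframe, ('a, 'b) biframe_map) cat"
  let ?F = "fin_biframe j"
  have fin_ob: "is_biframe (?F B)" "is_finitary (?F B)" "id_map B \<in> biframe_hom (?F B) B"
    if "is_biframe B" for B
  proof -
    interpret biframe_struct B by unfold_locales fact
    show "is_biframe (?F B)" "is_finitary (?F B)" "id_map B \<in> biframe_hom (?F B) B"
      using is_biframe_fin is_finitary_fin counit_hom assms by auto
  qed
  have unit: "id_map B \<in> biframe_hom B (?F B)" if "is_biframe B" "is_finitary B" for B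
    using biframe_struct.unit_hom[OF _ assms that(2)] that(1) by (simp add: biframe_struct_def)
  \<comment> \<open>Identities and composition in \<open>BiFrm\<close> refer only to the positive
    and negative components, which \<open>?F\<close> leaves unchanged; this fact and
    \<open>cmp\<close> let \<open>?F\<close> be erased from both.\<close>
  have id: "id_map (?F B) = id_map B" for B
    by (simp add: id_map_def fin_biframe_def Let_def)
  have cmp: "Cmp BiFrm (?F X) Y Z = Cmp BiFrm X Y Z" "Cmp BiFrm X (?F Y) Z = Cmp BiFrm X Y Z"
      "Cmp BiFrm X Y (?F Z) = Cmp BiFrm X Y Z" for X Y Z :: "('a, 'b, 'l) biframe"
    by (simp_all add: BiFrm_def fin_biframe_def Let_def)
  have hom: "f \<in> biframe_hom (?F X) (?F Y)"
    if "is_biframe X" "is_biframe Y" "f \<in> biframe_hom X Y" for X Y f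
    using fin_biframe_hom[OF that(1,2) assms assms, of "fst f" "snd f"] that(3) by simp
  note defs = incl_functor_def fin_functor_def id_functor_def comp_functor_def
  have incl: "is_functor ?C ?D incl_functor"
    unfolding is_functor_def
    by (auto simp: defs BiFrm_simps category_BiFrm category_BiFrm_fin)
  have fin: "is_functor ?D ?C (fin_functor j)"
    unfolding is_functor_def
    by (auto simp: defs BiFrm_simps category_BiFrm category_BiFrm_fin fin_ob hom id cmp)
  have unit_nat: "nat_transf ?C ?C id_functor (comp_functor (fin_functor j) incl_functor) id_map"
    unfolding nat_transf_def is_functor_def
    by (auto simp: category_BiFrm_fin defs BiFrm_simps fin_ob hom id cmp unit Cmp_id_map)
  have counit_nat: "nat_transf ?D ?D (comp_functor incl_functor (fin_functor j)) id_functor id_map"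
    unfolding nat_transf_def is_functor_def
    by (auto simp: category_BiFrm defs BiFrm_simps fin_ob hom id cmp Cmp_id_map)
  \<comment> \<open>All components being identity pairs, each triangle identity says that an
    identity composed with itself is the identity.\<close>
  show ?thesis
    unfolding adjunction_def using incl fin unit_nat counit_nat
    by (auto simp: defs BiFrm_simps id cmp Cmp_id_map id_map_hom)
qed

end
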